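(* Let $\mathcal{L}$ be a subspace lattice on a complex Banach space $X$ and let $\mathcal{A}=\mathrm{alg}\,\mathcal{L}$. Suppose there exists a non-trivial idempotent $P\in\mathcal{A}$ such that $\mathrm{ran}(P)\in\mathcal{L}$ and $PB(X)(I-P)\subseteq\mathcal{A}$. If $\delta\in L(\mathcal{A},B(X))$ is Jordan derivable at some $C\in\mathcal{A}$, then $\delta$ is a derivation. In particular, every $C\in\mathcal{A}$ is a Jordan all-derivable point of $L(\mathcal{A},B(X))$.
   Context: $B(X)$ is the algebra of all bounded linear operators on $X$. A subspace lattice on $X$ is a collection $\mathcal{L}$ of closed subspaces of $X$ with $(0),X\in\mathcal{L}$ such that for every family $\{M_r\}$ of elements of $\mathcal{L}$, both the intersection $\cap M_r$ and the closed linear span $\vee M_r$ belong to $\mathcal{L}$. $\mathrm{alg}\,\mathcal{L}$ is the algebra of all operators in $B(X)$ that leave every member of $\mathcal{L}$ invariant. A non-trivial idempotent is one different from $0$ and $I$. $L(\mathcal{A},B(X))$ is the set of all (not necessarily bounded) linear mappings from $\mathcal{A}$ to $B(X)$. Such a $\delta$ is a derivation if $\delta(AB)=\delta(A)B+A\delta(B)$ for all $A,B\in\mathcal{A}$; a Jordan derivation if $\delta(AB+BA)=\delta(A)B+A\delta(B)+\delta(B)A+B\delta(A)$ for all $A,B\in\mathcal{A}$; and Jordan derivable at $C\in\mathcal{A}$ if the latter identity holds for all $A,B\in\mathcal{A}$ with $AB=C$. An element $C\in\mathcal{A}$ is a Jordan all-derivable point of $L(\mathcal{A},B(X))$ if every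 $\delta\in L(\mathcal{A},B(X))$ that is Jordan derivable at $C$ is a Jordan derivation. *)

theory Defs
  imports "HOL-Analysis.Analysis"
begin

section \<open>Complex Banach spaces\<close>

text \<open>The classes extend those of the library, which only know real scalars, in such a way that
  every complex normed space is also a real normed space with the same norm.\<close>

class complex_vector = ab_group_add +
  fixes scaleC :: "complex \<Rightarrow> 'a \<Rightarrow> 'a" (infixr \<open>*\<^sub>C\<close> 75)
  assumes scaleC_add_right: "a *\<^sub>C (x + y) = a *\<^sub>C x + a *\<^sub>C y"
    and scaleC_add_left: "(a + b) *\<^sub>C x = a *\<^sub>C x + b *\<^sub>C x"
    and scaleC_scaleC: "a *\<^sub>C b *\<^sub>C x = (a * b) *\<^sub>C x"
    and scaleC_one: "1 *\<^sub>C x = x"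

class complex_normed_vector = complex_vector + real_normed_vector +
  assumes scaleR_scaleC: "r *\<^sub>R x = complex_of_real r *\<^sub>C x"
    and norm_scaleC: "norm (a *\<^sub>C x) = cmod a * norm x"

class complex_banach = complex_normed_vector + complete_space
begin
subclass banach ..
end

global_interpretation complex_vector: vector_space "scaleC :: complex \<Rightarrow> 'a \<Rightarrow> 'a :: complex_vector"
  defines csubspace = complex_vector.subspace
    and cspan = complex_vector.span
  by unfold_locales (simp_all add: scaleC_add_right scaleC_add_left scaleC_scaleC scaleC_one)

abbreviation clinear :: "('a::complex_vector \<Rightarrow> 'b::complex_vector) \<Rightarrow> bool"
  where "clinear \<equiv> Vector_Spaces.linear scaleC scaleC"

lemma clinear_iff:
  "clinear f \<longleftrightarrow> (\<forall>x y. f (x + y) = f x + f y) \<and> (\<forall>c x. f (c *\<^sub>C x) = c *\<^sub>C f x)"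
  by (simp add: Vector_Spaces.linear_def module_hom_def module_hom_axioms_def module_iff_vector_space
      complex_vector.vector_space_axioms)

instantiation complex :: complex_banach
begin
definition scaleC_complex :: "complex \<Rightarrow> complex \<Rightarrow> complex" where "scaleC_complex = (*)"
instance
  by standard (auto simp: scaleC_complex_def algebra_simps norm_mult scaleR_conv_of_real)
end


section \<open>The algebra of bounded operators\<close>

typedef (overloaded) 'a bop =
  "{T :: 'a::complex_normed_vector \<Rightarrow> 'a. clinear T \<and> (\<exists>K. \<forall>x. norm (T x) \<le> K * norm x)}"
  morphisms bop_apply Bop
proof (rule exI[of _ "\<lambda>x. x"])
  show "(\<lambda>x. x) \<in> {T :: 'a \<Rightarrow> 'a. clinear T \<and> (\<exists>K. \<forall>x. norm (T x) \<le> K * norm x)}"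
    by (auto simp: clinear_iff intro: exI[of _ 1])
qed

setup_lifting type_definition_bop

lemma bop_eqI: "(\<And>x. bop_apply S x = bop_apply T x) \<Longrightarrow> S = T"
  by transfer auto

text \<open>Multiplication is composition and \<open>1\<close> is the identity operator. There is no \<open>ring_1\<close>
  instance, since \<open>0 = 1\<close> holds if the underlying space is zero.\<close>

instantiation bop :: (complex_normed_vector) "{ring, monoid_mult, complex_vector}"
begin

lift_definition zero_bop :: "'a bop" is "\<lambda>x. 0"
  by (auto simp: clinear_iff intro: exI[of _ 0])

lift_definition one_bop :: "'a bop" is "\<lambda>x. x"
  by (auto simp: clinear_iff intro: exI[of _ 1])

lift_definition plus_bop :: "'a bop \<Rightarrow> 'a bop \<Rightarrow> 'a bop" is "\<lambda>S T x. S x + T x"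
proof -
  fix S T :: "'a \<Rightarrow> 'a"
  assume *: "clinear S \<and> (\<exists>K. \<forall>x. norm (S x) \<le> K * norm x)"
    "clinear T \<and> (\<exists>K. \<forall>x. norm (T x) \<le> K * norm x)"
  then obtain K L where "\<And>x. norm (S x) \<le> K * norm x" "\<And>x. norm (T x) \<le> L * norm x"
    by blast
  then have "norm (S x + T x) \<le> (K + L) * norm x" for x
    using norm_triangle_mono by (metis distrib_right)
  then show "clinear (\<lambda>x. S x + T x) \<and> (\<exists>K. \<forall>x. norm (S x + T x) \<le> K * norm x)"
    using * by (auto simp: clinear_iff scaleC_add_right)
qed

lift_definition uminus_bop :: "'a bop \<Rightarrow> 'a bop" is "\<lambda>T x. - T x"
  by (auto simp: clinear_iff)

lift_definition minus_bop :: "'a bop \<Rightarrow> 'a bop \<Rightarrow> 'a bop" is "\<lambda>S T x. S x - T x"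
proof -
  fix S T :: "'a \<Rightarrow> 'a"
  assume *: "clinear S \<and> (\<exists>K. \<forall>x. norm (S x) \<le> K * norm x)"
    "clinear T \<and> (\<exists>K. \<forall>x. norm (T x) \<le> K * norm x)"
  then obtain K L where "\<And>x. norm (S x) \<le> K * norm x" "\<And>x. norm (T x) \<le> L * norm x"
    by blast
  then have "norm (S x - T x) \<le> (K + L) * norm x" for x
    using norm_triangle_le_diff add_mono by (metis distrib_right)
  then show "clinear (\<lambda>x. S x - T x) \<and> (\<exists>K. \<forall>x. norm (S x - T x) \<le> K * norm x)"
    using * by (auto simp: clinear_iff complex_vector.scale_right_diff_distrib)
qed

lift_definition times_bop :: "'a bop \<Rightarrow> 'a bop \<Rightarrow> 'a bop" is "\<lambda>S T x. S (T x)"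
proof -
  fix S T :: "'a \<Rightarrow> 'a"
  assume *: "clinear S \<and> (\<exists>K. \<forall>x. norm (S x) \<le> K * norm x)"
    "clinear T \<and> (\<exists>K. \<forall>x. norm (T x) \<le> K * norm x)"
  then obtain K L where K: "\<And>x. norm (S x) \<le> K * norm x" and L: "\<And>x. norm (T x) \<le> L * norm x"
    by blast
  have "norm (S (T x)) \<le> (\<bar>K\<bar> * L) * norm x" for x
  proof -
    have "norm (S (T x)) \<le> \<bar>K\<bar> * norm (T x)"
      using K[of "T x"] mult_right_mono[OF abs_ge_self norm_ge_zero] by (rule order_trans)
    also have "\<dots> \<le> \<bar>K\<bar> * (L * norm x)"
      by (intro mult_left_mono L) simp
    finally show ?thesis by (simp add: mult.assoc)
  qed
  then show "clinear (\<lambda>x. S (T x)) \<and> (\<exists>K. \<forall>x. norm (S (T x)) \<le> K * norm x)"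
    using * by (auto simp: clinear_iff)
qed

lift_definition scaleC_bop :: "complex \<Rightarrow> 'a bop \<Rightarrow> 'a bop" is "\<lambda>c T x. c *\<^sub>C T x"
proof -
  fix c and T :: "'a \<Rightarrow> 'a"
  assume *: "clinear T \<and> (\<exists>K. \<forall>x. norm (T x) \<le> K * norm x)"
  then obtain K where "\<And>x. norm (T x) \<le> K * norm x" by blast
  then have "norm (c *\<^sub>C T x) \<le> (cmod c * K) * norm x" for x
    by (simp add: norm_scaleC mult.assoc mult_left_mono)
  then show "clinear (\<lambda>x. c *\<^sub>C T x) \<and> (\<exists>K. \<forall>x. norm (c *\<^sub>C T x) \<le> K * norm x)"
    using * by (intro conjI exI[of _ "cmod c * K"])
      (auto simp: clinear_iff scaleC_add_right scaleC_scaleC mult.commute)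
qed

instance
  by standard
    (transfer; simp add: clinear_iff fun_eq_iff algebra_simps scaleC_add_right scaleC_add_left scaleC_scaleC scaleC_one)+

end


section \<open>Subspace lattices and their algebras\<close>

definition subspace_lattice :: "'a::complex_normed_vector set set \<Rightarrow> bool" where
  "subspace_lattice \<L> \<longleftrightarrow>
     (\<forall>M\<in>\<L>. csubspace M \<and> closed M) \<and> {0} \<in> \<L> \<and> UNIV \<in> \<L> \<and>
     (\<forall>F. F \<subseteq> \<L> \<longrightarrow> \<Inter>F \<in> \<L> \<and> closure (cspan (\<Union>F)) \<in> \<L>)"

definition alg :: "'a::complex_normed_vector set set \<Rightarrow> 'a bop set" where
  "alg \<L> = {A. \<forall>M\<in>\<L>. \<forall>x\<in>M. bop_apply A x \<in> M}"


section \<open>Derivations\<close>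

text \<open>The set of linear maps from \<open>\<A>\<close> to the algebra of all bounded operators. Maps are total
  functions, but only their values on \<open>\<A>\<close> are ever constrained. Here and below, \<open>\<A>\<close> is meant to
  be a subalgebra.\<close>

definition linear_maps ::
    "'a::complex_normed_vector bop set \<Rightarrow> ('a bop \<Rightarrow> 'a bop) set" where
  "linear_maps \<A> = {\<delta>. (\<forall>A\<in>\<A>. \<forall>B\<in>\<A>. \<delta> (A + B) = \<delta> A + \<delta> B) \<and>
                        (\<forall>c. \<forall>A\<in>\<A>. \<delta> (c *\<^sub>C A) = c *\<^sub>C \<delta> A)}"

definition derivation_on ::
    "'a::complex_normed_vector bop set \<Rightarrow> ('a bop \<Rightarrow> 'a bop) \<Rightarrow> bool" where
  "derivation_on \<A> \<delta> \<longleftrightarrow> \<delta> \<in> linear_maps \<A> \<and>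
     (\<forall>A\<in>\<A>. \<forall>B\<in>\<A>. \<delta> (A * B) = \<delta> A * B + A * \<delta> B)"

definition jordan_derivation_on ::
    "'a::complex_normed_vector bop set \<Rightarrow> ('a bop \<Rightarrow> 'a bop) \<Rightarrow> bool" where
  "jordan_derivation_on \<A> \<delta> \<longleftrightarrow> \<delta> \<in> linear_maps \<A> \<and>
     (\<forall>A\<in>\<A>. \<forall>B\<in>\<A>. \<delta> (A * B + B * A) = \<delta> A * B + A * \<delta> B + \<delta> B * A + B * \<delta> A)"

definition jordan_derivable_at ::
    "'a::complex_normed_vector bop set \<Rightarrow> 'a bop \<Rightarrow> ('a bop \<Rightarrow> 'a bop) \<Rightarrow> bool" where
  "jordan_derivable_at \<A> C \<delta> \<longleftrightarrow> \<delta> \<in> linear_maps \<A> \<and> C \<in> \<A> \<and>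
     (\<forall>A\<in>\<A>. \<forall>B\<in>\<A>. A * B = C \<longrightarrow>
        \<delta> (A * B + B * A) = \<delta> A * B + A * \<delta> B + \<delta> B * A + B * \<delta> A)"

definition jordan_all_derivable_point ::
    "'a::complex_normed_vector bop set \<Rightarrow> 'a bop \<Rightarrow> bool" where
  "jordan_all_derivable_point \<A> C \<longleftrightarrow> C \<in> \<A> \<and>
     (\<forall>\<delta>\<in>linear_maps \<A>. jordan_derivable_at \<A> C \<delta> \<longrightarrow> jordan_derivation_on \<A> \<delta>)"

end

theory Submission
  imports Defs
begin

text \<open>Write \<open>Q = 1 - P\<close>, so that \<open>\<A>\<close> is block upper triangular with full corner \<open>P B(X) Q\<close>, and let
  \<open>\<Phi>(A, B) = \<delta>(AB + BA) - \<delta>(A)B - A\<delta>(B) - \<delta>(B)A - B\<delta>(A)\<close>. For invertible \<open>S \<in> P\<A>P\<close> and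
  \<open>T \<in> Q\<A>Q\<close> and every \<open>N \<in> P B(X) Q\<close>, the point \<open>C\<close> is the product of \<open>S + N + QCT\<inverse>\<close> and
  \<open>S\<inverse>PC - S\<inverse>NT + T\<close>. Replacing \<open>S\<close> and \<open>N\<close> by scalar multiples and comparing coefficients gives,
  whatever \<open>C\<close> is, \<open>\<Phi>(S, T) = 0\<close>, \<open>\<Phi>(N, T) = \<Phi>(S, S\<inverse>NT)\<close> and \<open>\<Phi>(N, N) = 0\<close>. By Neumann series,
  each corner algebra is spanned by its invertible elements, so these identities extend to all
  of \<open>P\<A>P\<close> and \<open>Q\<A>Q\<close>. After subtraction of an inner derivation, \<open>\<delta>\<close> therefore preserves the block
  decomposition, and \<open>\<delta>(1)\<close> commutes with \<open>P B(X) Q\<close>. By the Hahn-Banach theorem this corner contains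
  enough rank one operators to act faithfully; hence \<open>\<delta>(1)\<close> is a scalar \<open>d\<close>. If \<open>C \<noteq> 0\<close>, the
  factorization \<open>C = 1 C\<close> forces \<open>2dC = 0\<close>; if \<open>C = 0\<close>, then \<open>C = N P\<close> forces \<open>dN = 0\<close>. So \<open>d = 0\<close>, and
  the product rule on products with \<open>P B(X) Q\<close> passes by faithfulness to the diagonal blocks.\<close>

section \<open>Hahn-Banach\<close>

definition sublinear :: "('a::real_vector \<Rightarrow> real) \<Rightarrow> bool" where
  "sublinear p \<longleftrightarrow> (\<forall>x y. p (x + y) \<le> p x + p y) \<and> (\<forall>t x. 0 < t \<longrightarrow> p (t *\<^sub>R x) = t * p x)"

lemma sublinear_add: "sublinear p \<Longrightarrow> p (x + y) \<le> p x + p y"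
  and sublinear_scale: "sublinear p \<Longrightarrow> 0 < t \<Longrightarrow> p (t *\<^sub>R x) = t * p x"
  by (auto simp: sublinear_def)

lemma sublinear_zero: "sublinear p \<Longrightarrow> p 0 = 0"
  using sublinear_scale[of p 2 0] by simp

lemma sublinear_minus: "sublinear p \<Longrightarrow> - p (- x) \<le> p x"
  using sublinear_add[of p x "- x"] sublinear_zero[of p] by simp

text \<open>Taking the infimum of \<open>p\<close> along the ray from \<open>x\<close> in direction
  \<open>y\<close>, corrected by \<open>t * p y\<close>, keeps sublinearity; the parameters
  \<open>t = 0\<close> and \<open>t = 1\<close> give the two bounds.\<close>

lemma sublinear_tilt:
  assumes p: "sublinear p"
  obtains q where "sublinear q" "\<And>x. q x \<le> p x" "\<And>x. q x \<le> p (x + y) - p y"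
proof -
  define q where "q x = (INF t\<in>{0..}. p (x + t *\<^sub>R y) - t * p y)" for x
  \<comment> \<open>Subadditivity at \<open>x + t *\<^sub>R y\<close> and \<open>- x\<close> bounds
    all terms from below, so the infimum is finite.\<close>
  have lb: "- p (- x) \<le> p (x + t *\<^sub>R y) - t * p y" if "0 \<le> t" for t x
  proof -
    have "t * p y = p (t *\<^sub>R y)"
      using that p by (cases "t = 0") (auto simp: sublinear_scale sublinear_zero)
    then show ?thesis using sublinear_add[OF p, of "x + t *\<^sub>R y" "- x"] by simp
  qed
  have bdd: "bdd_below ((\<lambda>t. p (x + t *\<^sub>R y) - t * p y) ` {0..})" for x
    using lb by (intro bdd_belowI[of _ "- p (- x)"]) auto
  have q_le: "q x \<le> p (x + t *\<^sub>R y) - t * p y" if "0 \<le> t" for t x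
    unfolding q_def using that bdd by (intro cINF_lower) auto
  have q_ge: "c \<le> q x" if "\<And>t. 0 \<le> t \<Longrightarrow> c \<le> p (x + t *\<^sub>R y) - t * p y" for c x
    unfolding q_def using that by (intro cINF_greatest) auto
  have "q (x + z) \<le> q x + q z" for x z
  proof -
    \<comment> \<open>The parameter \<open>s + t\<close> is admissible for \<open>x + z\<close>. The
      infimum over \<open>s\<close> is taken first, then the one over \<open>t\<close>.\<close>
    have "q (x + z) - (p (x + t *\<^sub>R y) - t * p y) \<le> p (z + s *\<^sub>R y) - s * p y"
      if "0 \<le> s" "0 \<le> t" for s t
      using q_le[of "s + t" "x + z"] sublinear_add[OF p, of "x + t *\<^sub>R y" "z + s *\<^sub>R y"] that
      by (simp add: algebra_simps)
    then have "q (x + z) - (p (x + t *\<^sub>R y) - t * p y) \<le> q z" if "0 \<le> t" for t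
      using that by (intro q_ge)
    then have "q (x + z) - q z \<le> q x"
      by (intro q_ge) (smt (verit))
    then show ?thesis by simp
  qed
  \<comment> \<open>Substituting \<open>t / c\<close> for the parameter gives one inequality; the
    converse is the same inequality at \<open>1 / c\<close> and
    \<open>c *\<^sub>R x\<close>.\<close>
  moreover have le: "c * q x \<le> q (c *\<^sub>R x)" if "0 < c" for c x
  proof (rule q_ge)
    fix t :: real assume "0 \<le> t"
    then have "c * q x \<le> c * (p (x + (t / c) *\<^sub>R y) - (t / c) * p y)"
      using that by (intro mult_left_mono q_le) auto
    also have "\<dots> = p (c *\<^sub>R (x + (t / c) *\<^sub>R y)) - t * p y"
      using that p by (simp add: sublinear_scale right_diff_distrib del: scaleR_add_right)
    finally show "c * q x \<le> p (c *\<^sub>R x + t *\<^sub>R y) - t * p y"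
      using that by (simp add: scaleR_add_right)
  qed
  have "q (c *\<^sub>R x) = c * q x" if "0 < c" for c x
  proof (rule antisym)
    show "q (c *\<^sub>R x) \<le> c * q x"
      using le[of "1 / c" "c *\<^sub>R x"] that by (simp add: field_simps)
  qed (use le that in blast)
  ultimately have "sublinear q" by (auto simp: sublinear_def)
  moreover have "q x \<le> p x" "q x \<le> p (x + y) - p y" for x
    using q_le[of 0 x] q_le[of 1 x] by auto
  ultimately show thesis using that by blast
qed

text \<open>Zorn's lemma for the reversed pointwise order: a nonempty chain is bounded below by its
  pointwise infimum, which is finite because all members dominate \<open>- p (- x)\<close>.\<close>

lemma minimal_sublinear_exists:
  assumes p: "sublinear p"
  obtains m where "sublinear m" "m \<le> p" "\<And>q. sublinear q \<Longrightarrow> q \<le> m \<Longrightarrow> q = m"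
proof -
  define A where "A = {q. sublinear q \<and> q \<le> p}"
  have "\<exists>m\<in>A. \<forall>a\<in>A. a \<le> m \<longrightarrow> a = m"
  proof (rule predicate_Zorn)
    show "partial_order_on A (relation_of (\<lambda>f g. g \<le> f) A)"
      by (rule partial_order_on_relation_ofI) auto
  next
    fix C assume C: "C \<in> Chains (relation_of (\<lambda>f g. g \<le> f) A)"
    then have CA: "C \<subseteq> A" and lin: "\<And>f g. f \<in> C \<Longrightarrow> g \<in> C \<Longrightarrow> f \<le> g \<or> g \<le> f"
      unfolding Chains_def relation_of_def by auto
    show "\<exists>u\<in>A. \<forall>a\<in>C. u \<le> a"
    proof (cases "C = {}")
      case True
      then show ?thesis using p by (auto simp: A_def)
    next
      case False
      define u where "u x = (INF f\<in>C. f x)" for x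
      have sub: "sublinear f" and le_p: "f x \<le> p x" if "f \<in> C" for f x
        using that CA by (auto simp: A_def le_fun_def)
      have "- p (- x) \<le> f x" if "f \<in> C" for f x
        using sublinear_minus[OF sub[OF that], of x] le_p[OF that, of "- x"] by simp
      then have bdd: "bdd_below ((\<lambda>f. f x) ` C)" for x
        by (intro bdd_belowI[of _ "- p (- x)"]) auto
      have u_le: "u x \<le> f x" if "f \<in> C" for f x
        unfolding u_def using that bdd by (intro cINF_lower) auto
      have u_ge: "c \<le> u x" if "\<And>f. f \<in> C \<Longrightarrow> c \<le> f x" for c x
        unfolding u_def using that False by (intro cINF_greatest) auto
      have "u (x + z) \<le> u x + u z" for x z
      proof -
        \<comment> \<open>An infimum of sublinear functions need not be subadditive; in a chain, the
          smaller of \<open>f\<close> and \<open>g\<close> can be used at both points.\<close>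
        have "u (x + z) - f x \<le> g z" if fg: "f \<in> C" "g \<in> C" for f g
        proof -
          consider "f \<le> g" | "g \<le> f" using lin[OF fg] by blast
          then show ?thesis
          proof cases
            case 1
            then show ?thesis
              using u_le[OF fg(1), of "x + z"] sublinear_add[OF sub[OF fg(1)], of x z]
              by (auto simp: le_fun_def dest!: spec[of _ z])
          next
            case 2
            then show ?thesis
              using u_le[OF fg(2), of "x + z"] sublinear_add[OF sub[OF fg(2)], of x z]
              by (auto simp: le_fun_def dest!: spec[of _ x])
          qed
        qed
        then have "u (x + z) - f x \<le> u z" if "f \<in> C" for f
          using that by (intro u_ge)
        then have "u (x + z) - u z \<le> u x"
          by (intro u_ge) (smt (verit))
        then show ?thesis by simp
      qed
      moreover have le: "c * u x \<le> u (c *\<^sub>R x)" if "0 < c" for c x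
      proof (rule u_ge)
        fix f assume "f \<in> C"
        then show "c * u x \<le> f (c *\<^sub>R x)"
          using that u_le[of f x] sub[of f] by (simp add: sublinear_scale)
      qed
      have "u (c *\<^sub>R x) = c * u x" if "0 < c" for c x
      proof (rule antisym)
        show "u (c *\<^sub>R x) \<le> c * u x"
          using le[of "1 / c" "c *\<^sub>R x"] that by (simp add: field_simps)
      qed (use le that in blast)
      ultimately have "sublinear u" by (auto simp: sublinear_def)
      moreover have "u \<le> f" if "f \<in> C" for f
        using u_le[OF that] by (simp add: le_fun_def)
      moreover have "u \<le> p"
        using False u_le le_p unfolding le_fun_def by (meson ex_in_conv order_trans)
      ultimately show ?thesis by (auto simp: A_def)
    qed
  qed
  then obtain m where m: "m \<in> A" "\<And>a. a \<in> A \<Longrightarrow> a \<le> m \<Longrightarrow> a = m" by blast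
  show thesis
  proof
    show "sublinear m" "m \<le> p" using m(1) by (auto simp: A_def)
    show "q = m" if "sublinear q" "q \<le> m" for q
      using that m by (auto simp: A_def intro: order_trans)
  qed
qed

text \<open>Minimality means that no tilt decreases \<open>m\<close>, hence \<open>m x \<le> m (x + y) - m y\<close>.\<close>

lemma minimal_sublinear_linear:
  assumes m: "sublinear m" and min: "\<And>q. sublinear q \<Longrightarrow> q \<le> m \<Longrightarrow> q = m"
  shows "linear m"
proof -
  have add: "m (x + y) = m x + m y" for x y
  proof -
    obtain q where q: "sublinear q" "\<And>x. q x \<le> m x" "\<And>x. q x \<le> m (x + y) - m y"
      using sublinear_tilt[OF m, of y] by blast
    have "q = m" using min q by (simp add: le_fun_def)
    then show ?thesis using q(3)[of x] sublinear_add[OF m, of x y] by simp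
  qed
  have neg: "m (- x) = - m x" for x
    using add[of x "- x"] sublinear_zero[OF m] by simp
  show ?thesis
  proof (rule linearI)
    show "m (x + y) = m x + m y" for x y by (rule add)
    show "m (r *\<^sub>R x) = r *\<^sub>R m x" for r x
    proof (cases r "0::real" rule: linorder_cases)
      case less
      then have "m ((- r) *\<^sub>R x) = (- r) * m x" using m by (intro sublinear_scale) auto
      then show ?thesis by (simp add: neg)
    qed (use m in \<open>auto simp: sublinear_scale sublinear_zero\<close>)
  qed
qed

text \<open>Tilting the norm along \<open>x\<close> before minimising gives
  \<open>p (- x) \<le> - norm x\<close>, which forces \<open>f x \<ge> norm x\<close> for every
  linear \<open>f \<le> p\<close>.\<close>

lemma norming_functional_exists:
  fixes x :: "'a::real_normed_vector"
  obtains f where "linear f" "\<And>y. \<bar>f y\<bar> \<le> norm y" "f x = norm x"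
proof -
  have "sublinear (norm :: 'a \<Rightarrow> real)" by (auto simp: sublinear_def norm_triangle_ineq)
  then obtain p where p: "sublinear p" "\<And>y. p y \<le> norm y" "\<And>y. p y \<le> norm (y + x) - norm x"
    using sublinear_tilt by blast
  obtain f where f: "sublinear f" "f \<le> p" "\<And>q. sublinear q \<Longrightarrow> q \<le> f \<Longrightarrow> q = f"
    using minimal_sublinear_exists[OF p(1)] by blast
  have lin: "linear f" using f minimal_sublinear_linear by blast
  have f_le: "f y \<le> p y" for y using f(2) by (simp add: le_fun_def)
  have *: "f y \<le> norm y" for y using f_le[of y] p(2)[of y] by simp
  show thesis
  proof
    show "\<bar>f y\<bar> \<le> norm y" for y
      using *[of y] *[of "- y"] linear_neg[OF lin, of y] by simp
    show "f x = norm x"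
      using *[of x] f_le[of "- x"] p(3)[of "- x"] linear_neg[OF lin, of x] by simp
  qed (rule lin)
qed

text \<open>Complexification of a real norming functional \<open>g\<close>, with real part
  \<open>g y\<close> and imaginary part \<open>- g (\<i> *\<^sub>C y)\<close>. The factor 2 comes
  from bounding the modulus by the absolute values of both parts.\<close>

lemma complex_functional_exists:
  fixes x :: "'a::complex_normed_vector"
  assumes "x \<noteq> 0"
  obtains f :: "'a \<Rightarrow> complex" where "clinear f" "\<And>y. cmod (f y) \<le> 2 * norm y" "f x \<noteq> 0"
proof -
  obtain g where lin: "linear g" and g: "\<And>y. \<bar>g y\<bar> \<le> norm y" "g x = norm x"
    using norming_functional_exists by blast
  define f where "f y = Complex (g y) (- g (\<i> *\<^sub>C y))" for y
  have split: "c *\<^sub>C y = Re c *\<^sub>R y + Im c *\<^sub>R (\<i> *\<^sub>C y)" for c and y :: 'a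
    by (simp add: scaleR_scaleC scaleC_scaleC flip: scaleC_add_left) (simp add: complex_eq mult.commute)
  have isplit: "\<i> *\<^sub>C c *\<^sub>C y = Re c *\<^sub>R (\<i> *\<^sub>C y) - Im c *\<^sub>R y" for c and y :: 'a
    using split[of "\<i> * c" y] by (simp add: scaleC_scaleC)
  show thesis
  proof
    show "clinear f"
      unfolding clinear_iff f_def
    proof (intro conjI allI)
      fix c and y z :: 'a
      show "Complex (g (y + z)) (- g (\<i> *\<^sub>C (y + z))) =
          Complex (g y) (- g (\<i> *\<^sub>C y)) + Complex (g z) (- g (\<i> *\<^sub>C z))"
        by (simp add: scaleC_add_right linear_add[OF lin] complex_eq_iff)
      have "g (c *\<^sub>C y) = Re c * g y + Im c * g (\<i> *\<^sub>C y)"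
        "g (\<i> *\<^sub>C c *\<^sub>C y) = Re c * g (\<i> *\<^sub>C y) - Im c * g y"
        by (simp_all only: isplit) (simp_all only: split[of c y] linear_add[OF lin] linear_diff[OF lin]
            linear_scale[OF lin] real_scaleR_def)
      then show "Complex (g (c *\<^sub>C y)) (- g (\<i> *\<^sub>C c *\<^sub>C y)) = c *\<^sub>C Complex (g y) (- g (\<i> *\<^sub>C y))"
        by (simp add: scaleC_complex_def complex_eq_iff)
    qed
    show "cmod (f y) \<le> 2 * norm y" for y
      using cmod_le[of "f y"] g(1)[of y] g(1)[of "\<i> *\<^sub>C y"] by (simp add: f_def norm_scaleC)
    show "f x \<noteq> 0"
      using assms g(2) by (auto simp: f_def complex_eq_iff)
  qed
qed

section \<open>Bounded operators and Neumann series\<close>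

lemmas bop_apply_simps [simp] =
  zero_bop.rep_eq one_bop.rep_eq plus_bop.rep_eq uminus_bop.rep_eq minus_bop.rep_eq
  times_bop.rep_eq scaleC_bop.rep_eq

lemma bop_clinear: "clinear (bop_apply T)"
  and bop_bounded: "\<exists>K. \<forall>x. norm (bop_apply T x) \<le> K * norm x"
  using bop_apply[of T] by auto

lemma bop_add: "bop_apply T (x + y) = bop_apply T x + bop_apply T y"
  and bop_scale: "bop_apply T (c *\<^sub>C x) = c *\<^sub>C bop_apply T x"
  using bop_clinear[of T] by (auto simp: clinear_iff)

lemma bop_linear: "linear (bop_apply T)"
  by (rule linearI) (auto simp: bop_add bop_scale scaleR_scaleC)

lemma bop_bounded_linear: "bounded_linear (bop_apply T)"
proof -
  obtain K where "\<And>x. norm (bop_apply T x) \<le> K * norm x" using bop_bounded by blast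
  then show ?thesis
    by (intro bounded_linear_intro[where K = K])
      (auto simp: bop_add bop_scale scaleR_scaleC mult.commute)
qed

lemma bop_scaleC_mult [simp]:
  fixes S T :: "'a::complex_normed_vector bop"
  shows "(c *\<^sub>C S) * T = c *\<^sub>C (S * T)" "S * (c *\<^sub>C T) = c *\<^sub>C (S * T)"
  by (auto intro!: bop_eqI simp: bop_scale)

lemma alg_closed:
  assumes "subspace_lattice \<L>"
  shows one_in_alg: "1 \<in> alg \<L>"
    and add_in_alg: "A \<in> alg \<L> \<Longrightarrow> B \<in> alg \<L> \<Longrightarrow> A + B \<in> alg \<L>"
    and mult_in_alg: "A \<in> alg \<L> \<Longrightarrow> B \<in> alg \<L> \<Longrightarrow> A * B \<in> alg \<L>"
    and scale_in_alg: "A \<in> alg \<L> \<Longrightarrow> c *\<^sub>C A \<in> alg \<L>"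
  using assms
  by (auto simp: alg_def subspace_lattice_def csubspace_def
      intro: complex_vector.subspace_add complex_vector.subspace_scale)

text \<open>The Neumann series is summed pointwise, so that no operator norm is needed.\<close>

lemma neumann_inverse:
  fixes \<L> :: "'a::complex_banach set set"
  assumes \<L>: "subspace_lattice \<L>" and T: "T \<in> alg \<L>"
    and half: "\<And>x. norm (bop_apply T x) \<le> norm x / 2"
  obtains R where "R \<in> alg \<L>" "R * (1 - T) = 1" "(1 - T) * R = 1"
proof -
  let ?t = "\<lambda>x n. (bop_apply T ^^ n) x"
  have norm_t: "norm (?t x n) \<le> (1 / 2) ^ n * norm x" for x n
    proof (induction n)
    case (Suc n)
    then show ?case using half[of "?t x n"] by simp
  qed simp
  have geo: "(\<lambda>n. (1 / 2) ^ n * norm x) sums (2 * norm x)" for x :: 'a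
    using sums_mult2[OF geometric_sums[of "1 / 2 :: real"], of "norm x"] by simp
  have summ_norm: "summable (\<lambda>n. norm (?t x n))" for x
    by (rule summable_comparison_test'[OF sums_summable[OF geo[of x]]]) (simp add: norm_t)
  have summ: "summable (?t x)" for x
    by (rule summable_norm_cancel[OF summ_norm])
  define r where "r x = (\<Sum>n. ?t x n)" for x
  have t_add: "?t (x + y) n = ?t x n + ?t y n" for x y n
    by (induction n) (simp_all add: bop_add)
  have t_scale: "?t (c *\<^sub>C x) n = c *\<^sub>C ?t x n" for c x n
    by (induction n) (simp_all add: bop_scale)
  have bl: "bounded_linear ((*\<^sub>C) c :: 'a \<Rightarrow> 'a)" for c
    by (rule bounded_linear_intro[where K = "cmod c"])
      (auto simp: scaleC_add_right scaleR_scaleC scaleC_scaleC norm_scaleC mult.commute)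
  have r_add: "r (x + y) = r x + r y" for x y
    unfolding r_def t_add using suminf_add[OF summ summ] by simp
  have r_scale: "r (c *\<^sub>C x) = c *\<^sub>C r x" for c x
    unfolding r_def t_scale using bounded_linear.suminf[OF bl summ] by simp
  have "norm (r x) \<le> 2 * norm x" for x
  proof -
    have "norm (r x) \<le> (\<Sum>n. norm (?t x n))"
      unfolding r_def by (rule summable_norm[OF summ_norm])
    also have "\<dots> \<le> (\<Sum>n. (1 / 2) ^ n * norm x)"
      by (rule suminf_le[OF norm_t summ_norm sums_summable[OF geo]])
    also have "\<dots> = 2 * norm x" using sums_unique[OF geo[of x]] by simp
    finally show ?thesis .
  qed
  then have "r \<in> {T. clinear T \<and> (\<exists>K. \<forall>x. norm (T x) \<le> K * norm x)}"
    using r_add r_scale by (auto simp: clinear_iff)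
  then have R: "bop_apply (Bop r) = r" by (rule Bop_inverse)
  have t_Suc: "?t (bop_apply T x) n = ?t x (Suc n)" for x n
    by (simp only: funpow_Suc_right o_apply)
  have rT: "r (bop_apply T x) = r x - x" for x
    unfolding r_def t_Suc using suminf_split_head[OF summ[of x]] by simp
  have Tr: "bop_apply T (r x) = r x - x" for x
    unfolding r_def bounded_linear.suminf[OF bop_bounded_linear summ]
    using suminf_split_head[OF summ[of x]] by simp
  have r_diff: "r (x - y) = r x - r y" for x y
    by (metis add_diff_cancel diff_add_cancel r_add)
  show thesis
  proof
    show "Bop r * (1 - T) = 1" "(1 - T) * Bop r = 1"
      by (auto intro!: bop_eqI simp: R rT Tr r_diff)
    show "Bop r \<in> alg \<L>"
      unfolding alg_def R mem_Collect_eq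
    proof (intro ballI)
      fix M x assume M: "M \<in> \<L>" and x: "x \<in> M"
      have sub: "complex_vector.subspace M" and "closed M"
        using \<L> M by (auto simp: subspace_lattice_def csubspace_def)
      \<comment> \<open>The partial sums stay in the subspace \<open>M\<close>, and closedness of
        \<open>M\<close> carries this to the limit \<open>r x\<close>.\<close>
      have "?t x n \<in> M" for n
        using T M x by (induction n) (auto simp: alg_def)
      then have sums_in: "(\<Sum>i<n. ?t x i) \<in> M" for n
        using sub by (intro complex_vector.subspace_sum)
      have "(\<lambda>n. \<Sum>i<n. ?t x i) \<longlonglongrightarrow> r x"
        unfolding r_def using summable_LIMSEQ[OF summ] .
      then show "r x \<in> M"
        by (rule closed_sequentially[OF \<open>closed M\<close> sums_in])
    qed
  qed
qed

lemma alg_resolvent: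
  fixes \<L> :: "'a::complex_banach set set"
  assumes \<L>: "subspace_lattice \<L>" and A: "A \<in> alg \<L>"
  obtains c R where "c \<noteq> 0" "R \<in> alg \<L>" "R * (1 - c *\<^sub>C A) = 1" "(1 - c *\<^sub>C A) * R = 1"
proof -
  obtain K where K: "\<And>x. norm (bop_apply A x) \<le> K * norm x" using bop_bounded by blast
  \<comment> \<open>This scales \<open>A\<close> to norm at most one half;
    \<open>\<bar>K\<bar> + 1\<close> is positive whatever the sign of \<open>K\<close>.\<close>
  define c where "c = 1 / (2 * (\<bar>K\<bar> + 1))"
  have "0 < c" by (simp add: c_def add_nonneg_pos)
  have "norm (bop_apply (complex_of_real c *\<^sub>C A) x) \<le> norm x / 2" for x
  proof -
    have "norm (bop_apply A x) \<le> (\<bar>K\<bar> + 1) * norm x"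
      using K[of x] by (rule order_trans) (auto intro: mult_right_mono)
    then have "c * norm (bop_apply A x) \<le> c * ((\<bar>K\<bar> + 1) * norm x)"
      using \<open>0 < c\<close> by (intro mult_left_mono) auto
    also have "\<dots> = norm x / 2" by (simp add: c_def field_simps)
    finally show ?thesis using \<open>0 < c\<close> by (simp add: norm_scaleC)
  qed
  moreover have "complex_of_real c *\<^sub>C A \<in> alg \<L>" using scale_in_alg \<L> A by blast
  ultimately obtain R where "R \<in> alg \<L>" "R * (1 - complex_of_real c *\<^sub>C A) = 1"
      "(1 - complex_of_real c *\<^sub>C A) * R = 1"
    using neumann_inverse[OF \<L>] by blast
  moreover have "complex_of_real c \<noteq> 0" using \<open>0 < c\<close> by simp
  ultimately show thesis using that by blast
qed

section \<open>Rank one operators in a corner\<close>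

lemma bop_neqE:
  assumes "S \<noteq> T"
  obtains x where "bop_apply S x \<noteq> bop_apply T x"
  using assms bop_eqI[of S T] by blast

lemma rank_one_operator:
  fixes f :: "'a::complex_normed_vector \<Rightarrow> complex"
  assumes f: "clinear f" "\<And>y. cmod (f y) \<le> K * norm y"
  obtains T where "\<And>y. bop_apply T y = f y *\<^sub>C x"
proof -
  have "norm (f y *\<^sub>C x) \<le> (K * norm x) * norm y" for y
    using mult_right_mono[OF f(2)[of y] norm_ge_zero[of x]] by (simp add: norm_scaleC mult_ac)
  moreover have "f (y + z) = f y + f z" "f (c *\<^sub>C y) = c * f y" for c y z
    using f(1)[unfolded clinear_iff] by (auto simp: scaleC_complex_def)
  ultimately have *: "(\<lambda>y. f y *\<^sub>C x) \<in> {T. clinear T \<and> (\<exists>K. \<forall>y. norm (T y) \<le> K * norm y)}"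
    by (auto simp: clinear_iff scaleC_add_left scaleC_scaleC)
  show thesis by (rule that[of "Bop (\<lambda>y. f y *\<^sub>C x)"]) (simp add: Bop_inverse[OF *])
qed

text \<open>A functional composed with \<open>1 - P\<close> vanishes on the range of
  \<open>P\<close>, so tensored with a vector of that range it lies in the corner. One
  \<open>f\<close>, normalised at \<open>z\<close>, serves all \<open>x\<close>.\<close>

lemma corner_rank_one:
  fixes P :: "'a::complex_normed_vector bop"
  assumes z: "bop_apply (1 - P) z \<noteq> 0"
  obtains f where "f z = 1" "\<And>x. \<exists>S. \<forall>y. bop_apply (P * S * (1 - P)) y = f y *\<^sub>C bop_apply P x"
proof -
  obtain \<phi> where \<phi>: "clinear \<phi>" "\<And>y. cmod (\<phi> y) \<le> 2 * norm y" "\<phi> (bop_apply (1 - P) z) \<noteq> 0"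
    using complex_functional_exists[OF z] by blast
  define f where "f y = \<phi> (bop_apply (1 - P) y) / \<phi> (bop_apply (1 - P) z)" for y
  show thesis
  proof
    show "f z = 1" using \<phi>(3) by (simp add: f_def)
    fix x
    obtain S where "\<And>y. bop_apply S y = \<phi> y *\<^sub>C (inverse (\<phi> (bop_apply (1 - P) z)) *\<^sub>C x)"
      using rank_one_operator[OF \<phi>(1,2)] by blast
    then have "bop_apply (P * S * (1 - P)) y = f y *\<^sub>C bop_apply P x" for y
      by (simp add: f_def bop_scale scaleC_scaleC divide_inverse del: minus_bop.rep_eq)
    then show "\<exists>S. \<forall>y. bop_apply (P * S * (1 - P)) y = f y *\<^sub>C bop_apply P x" by blast
  qed
qed

text \<open>If \<open>f z = 1\<close>, then \<open>T\<close> times the rank one operator with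
  functional \<open>f\<close> and vector \<open>P x\<close> sends \<open>z\<close> to
  \<open>T P x\<close>. A suitable \<open>z\<close> exists because
  \<open>P \<noteq> 1\<close>.\<close>

lemma corner_faithful_left:
  fixes P :: "'a::complex_normed_vector bop"
  assumes "P \<noteq> 1" and T: "\<And>S. T * (P * S * (1 - P)) = 0"
  shows "T * P = 0"
proof (rule bop_eqI)
  fix x
  obtain z where z: "bop_apply (1 - P) z \<noteq> 0"
    using assms(1)[symmetric] by (rule bop_neqE) simp
  obtain f where f: "f z = 1" "\<And>x. \<exists>S. \<forall>y. bop_apply (P * S * (1 - P)) y = f y *\<^sub>C bop_apply P x"
    by (rule corner_rank_one[OF z]) blast
  then obtain S where "\<And>y. bop_apply (P * S * (1 - P)) y = f y *\<^sub>C bop_apply P x"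
    by blast
  then have "bop_apply (T * P) x = bop_apply (T * (P * S * (1 - P))) z"
    by (simp add: f(1) scaleC_one times_bop.rep_eq[of T] del: times_bop.rep_eq del: minus_bop.rep_eq)
  then show "bop_apply (T * P) x = bop_apply 0 x" by (simp add: T)
qed

text \<open>If \<open>(1 - P) T y\<close> were nonzero, some \<open>f\<close> would have value 1 at
  \<open>T y\<close>, and the product would send \<open>y\<close> to an arbitrary vector
  \<open>P x\<close>.\<close>

lemma corner_faithful_right:
  fixes P :: "'a::complex_normed_vector bop"
  assumes "P \<noteq> 0" and T: "\<And>S. P * S * (1 - P) * T = 0"
  shows "(1 - P) * T = 0"
proof (rule ccontr)
  assume "(1 - P) * T \<noteq> 0"
  then obtain y where y: "bop_apply (1 - P) (bop_apply T y) \<noteq> 0"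
    by (rule bop_neqE) simp
  obtain x where x: "bop_apply P x \<noteq> 0" using assms(1) by (rule bop_neqE) simp
  obtain f where f: "f (bop_apply T y) = 1"
      "\<And>x. \<exists>S. \<forall>y. bop_apply (P * S * (1 - P)) y = f y *\<^sub>C bop_apply P x"
    by (rule corner_rank_one[OF y]) blast
  then obtain S where "\<And>y. bop_apply (P * S * (1 - P)) y = f y *\<^sub>C bop_apply P x"
    by blast
  then have "bop_apply (P * S * (1 - P) * T) y = bop_apply P x"
    by (simp add: f(1) scaleC_one times_bop.rep_eq[of "P * S * (1 - P)" T] del: minus_bop.rep_eq times_bop.rep_eq)
  then show False using x by (simp add: T)
qed

text \<open>Let \<open>z = T P x\<close> and let \<open>N\<close> be the rank one operator with
  \<open>f z = 1\<close> and vector \<open>P x\<close>. Then \<open>N\<close> sends \<open>z\<close>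
  to \<open>P x\<close>, \<open>T\<close> sends it back to \<open>z\<close>, so
  \<open>N T N z = P x\<close>.\<close>

lemma corner_square_faithful:
  fixes P :: "'a::complex_normed_vector bop"
  assumes T: "\<And>S. P * S * (1 - P) * T * (P * S * (1 - P)) = 0"
  shows "(1 - P) * T * P = 0"
proof (rule ccontr)
  assume "(1 - P) * T * P \<noteq> 0"
  then obtain x where y: "bop_apply (1 - P) (bop_apply T (bop_apply P x)) \<noteq> 0"
    by (rule bop_neqE) simp
  define z where "z = bop_apply T (bop_apply P x)"
  obtain f where f: "f z = 1" "\<And>x. \<exists>S. \<forall>y. bop_apply (P * S * (1 - P)) y = f y *\<^sub>C bop_apply P x"
    unfolding z_def by (rule corner_rank_one[OF y]) blast
  then obtain S where S: "\<And>y. bop_apply (P * S * (1 - P)) y = f y *\<^sub>C bop_apply P x"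
    by blast
  have "bop_apply (P * S * (1 - P) * T * (P * S * (1 - P))) z = bop_apply P x"
    unfolding times_bop.rep_eq[of "P * S * (1 - P) * T"] times_bop.rep_eq[of "P * S * (1 - P)" T] S f(1)
    by (simp add: scaleC_one f(1) flip: z_def)
  then have "z = 0" by (simp add: T z_def bop_linear linear_0)
  then show False using y by (simp add: z_def[symmetric] linear_0[OF bop_linear])
qed

text \<open>Commuting with the rank one operators and evaluating at \<open>z\<close> gives
  \<open>D P x = f (D z) P x\<close>, with a factor independent of \<open>x\<close>. The other block
  follows by faithfulness on the right.\<close>

lemma corner_commutant_scalar:
  fixes P :: "'a::complex_normed_vector bop"
  assumes P: "P \<noteq> 0" "P \<noteq> 1" and D: "\<And>S. D * (P * S * (1 - P)) = P * S * (1 - P) * D"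
  obtains d where "D * P = d *\<^sub>C P" "(1 - P) * D = d *\<^sub>C (1 - P)"
proof -
  obtain z where z: "bop_apply (1 - P) z \<noteq> 0"
    using P(2)[symmetric] by (rule bop_neqE) simp
  obtain f where f: "f z = 1"
      "\<And>x. \<exists>S. \<forall>y. bop_apply (P * S * (1 - P)) y = f y *\<^sub>C bop_apply P x"
    by (rule corner_rank_one[OF z]) blast
  define d where "d = f (bop_apply D z)"
  have DP: "D * P = d *\<^sub>C P"
  proof (rule bop_eqI)
    fix x
    obtain S where S: "\<And>y. bop_apply (P * S * (1 - P)) y = f y *\<^sub>C bop_apply P x"
      using f(2) by blast
    have "bop_apply D (bop_apply (P * S * (1 - P)) z) = bop_apply (P * S * (1 - P)) (bop_apply D z)"
      using arg_cong[OF D[of S], of "\<lambda>T. bop_apply T z"] by simp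
    then show "bop_apply (D * P) x = bop_apply (d *\<^sub>C P) x"
      unfolding S f(1) by (simp add: d_def scaleC_one)
  qed
  have "P * S * (1 - P) * (D - d *\<^sub>C 1) = 0" for S
  proof -
    have "P * S * (1 - P) * D = D * P * (S * (1 - P))" using D[of S] by (simp only: mult.assoc)
    also have "\<dots> = d *\<^sub>C (P * S * (1 - P))" by (simp add: DP mult.assoc)
    finally show ?thesis by (simp add: right_diff_distrib)
  qed
  then have "(1 - P) * (D - d *\<^sub>C 1) = 0" by (rule corner_faithful_right[OF P(1)])
  then have "(1 - P) * D = d *\<^sub>C (1 - P)" by (simp add: right_diff_distrib)
  then show thesis using DP that by blast
qed

section \<open>Jordan derivable maps on triangular algebras\<close>

lemma vec_double: "x + x = 0 \<Longrightarrow> x = 0" for x :: "'a::complex_vector"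
proof -
  assume "x + x = 0"
  moreover have "x + x = 2 *\<^sub>C x" using scaleC_add_left[of 1 1 x] by (simp add: scaleC_one)
  ultimately show "x = 0" by simp
qed

text \<open>The values \<open>s = 1\<close> and \<open>s = -1\<close> separate the terms even in
  \<open>s\<close> from the odd ones; \<open>n = 0\<close>, \<open>n = 1\<close> and
  \<open>n = -1\<close> then separate the powers of \<open>n\<close>.\<close>

lemma coefficients_zero:
  fixes a b c d e f :: "'a::complex_vector"
  assumes "\<And>s n. s \<noteq> 0 \<Longrightarrow>
    a + n *\<^sub>C b + s *\<^sub>C c + inverse s *\<^sub>C (d + n *\<^sub>C e + (n * n) *\<^sub>C f) = 0"
  shows "b = 0" "c = 0" "f = 0"
proof -
  have p: "a + n *\<^sub>C b + (c + (d + n *\<^sub>C e + (n * n) *\<^sub>C f)) = 0" for n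
    using assms[of 1 n] by (simp add: scaleC_one add.assoc)
  have m: "a + n *\<^sub>C b - (c + (d + n *\<^sub>C e + (n * n) *\<^sub>C f)) = 0" for n
    using assms[of "-1" n] by (simp add: scaleC_one algebra_simps)
  have ab: "a + n *\<^sub>C b = 0" for n
    by (rule vec_double) (use p[of n] m[of n] in simp)
  have cdef: "c + (d + n *\<^sub>C e + (n * n) *\<^sub>C f) = 0" for n
    using p[of n] ab[of n] by simp
  have a: "a = 0" using ab[of 0] by simp
  show "b = 0" using ab[of 1] a by (simp add: scaleC_one)
  have cd: "c + d = 0" using cdef[of 0] by simp
  have "(c + d) + (e + f) = 0" using cdef[of 1] by (simp add: scaleC_one add_ac)
  then have ef: "e + f = 0" using cd by simp
  have "(c + d) + (f - e) = 0" using cdef[of "-1"] by (simp add: scaleC_one algebra_simps)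
  then have fe: "f = e" using cd by simp
  show "f = 0" by (rule vec_double) (use ef fe in simp)
  \<comment> \<open>So far only \<open>c + d = 0\<close> is known; the value \<open>s = 2\<close>
    weights \<open>c\<close> and \<open>d\<close> differently.\<close>
  have "2 *\<^sub>C c + inverse 2 *\<^sub>C d = 0" using assms[of 2 0] a by simp
  moreover have "d = - c" using cd by (simp add: eq_neg_iff_add_eq_0 add.commute)
  ultimately have "(2 - inverse 2) *\<^sub>C c = 0"
    by (simp only: complex_vector.scale_left_diff_distrib complex_vector.scale_minus_right add_uminus_conv_diff)
  then show "c = 0" by simp
qed

lemma linear_mapsD:
  fixes A B :: "'a::complex_normed_vector bop"
  assumes "\<delta> \<in> linear_maps \<A>" "A \<in> \<A>"
  shows linear_maps_add: "B \<in> \<A> \<Longrightarrow> \<delta> (A + B) = \<delta> A + \<delta> B"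
    and linear_maps_scale: "\<delta> (c *\<^sub>C A) = c *\<^sub>C \<delta> A"
  using assms by (auto simp: linear_maps_def)

definition jordan_defect ::
    "('a::complex_normed_vector bop \<Rightarrow> 'a bop) \<Rightarrow> 'a bop \<Rightarrow> 'a bop \<Rightarrow> 'a bop" where
  "jordan_defect \<delta> A B = \<delta> (A * B + B * A) - (\<delta> A * B + A * \<delta> B + \<delta> B * A + B * \<delta> A)"

section \<open>Block calculus in a triangular algebra with full corner\<close>

text \<open>The interface between lattices and algebra: \<open>triangular\<close> encodes invariance
  of the range of \<open>P\<close>, and \<open>resolvent\<close> is what the Neumann series
  provides.\<close>

locale corner_algebra =
  fixes \<A> :: "'a::complex_banach bop set" and P :: "'a bop"
  assumes one: "1 \<in> \<A>"
    and add: "A \<in> \<A> \<Longrightarrow> B \<in> \<A> \<Longrightarrow> A + B \<in> \<A>"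
    and mult: "A \<in> \<A> \<Longrightarrow> B \<in> \<A> \<Longrightarrow> A * B \<in> \<A>"
    and scale: "A \<in> \<A> \<Longrightarrow> c *\<^sub>C A \<in> \<A>"
    and resolvent: "A \<in> \<A> \<Longrightarrow> \<exists>c R. c \<noteq> 0 \<and> R \<in> \<A> \<and> R * (1 - c *\<^sub>C A) = 1 \<and> (1 - c *\<^sub>C A) * R = 1"
    and P: "P \<in> \<A>" "P * P = P" "P \<noteq> 0" "P \<noteq> 1"
    and triangular: "A \<in> \<A> \<Longrightarrow> (1 - P) * A * P = 0"
    and corner: "P * T * (1 - P) \<in> \<A>"
begin

definition Q :: "'a bop" where "Q = 1 - P"

lemma minus_eq: "- A = (-1) *\<^sub>C A" and diff_eq: "A - B = A + (-1) *\<^sub>C B" for A B :: "'a bop"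
  by (auto intro!: bop_eqI simp: complex_vector.scale_minus_left scaleC_one)

lemma minus: "A \<in> \<A> \<Longrightarrow> - A \<in> \<A>" and diff: "A \<in> \<A> \<Longrightarrow> B \<in> \<A> \<Longrightarrow> A - B \<in> \<A>"
  by (simp_all only: minus_eq diff_eq add scale)

lemma Q: "Q \<in> \<A>" by (simp add: Q_def diff one P)

lemma zero: "0 \<in> \<A>" using diff[OF one one] by simp

lemmas closed = one zero P(1) Q add mult scale minus diff

lemma PQ [simp]: "P * P = P" "Q * Q = Q" "P * Q = 0" "Q * P = 0"
    "P * (P * X) = P * X" "Q * (Q * X) = Q * X" "P * (Q * X) = 0" "Q * (P * X) = 0" "P + Q = 1"
proof -
  show *: "P * P = P" "Q * Q = Q" "P * Q = 0" "Q * P = 0" "P + Q = 1"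
    using P(2) by (simp_all add: Q_def algebra_simps)
  show "P * (P * X) = P * X" "Q * (Q * X) = Q * X" "P * (Q * X) = 0" "Q * (P * X) = 0"
    by (simp_all only: * mult_zero_left flip: mult.assoc)
qed

text \<open>Membership in \<open>lft E\<close> and \<open>rgt E\<close> serves as a condition of rewrite rules for block computations.\<close>

definition lft :: "'a bop \<Rightarrow> 'a bop set" where "lft E = {X. E * X = X}"

definition rgt :: "'a bop \<Rightarrow> 'a bop set" where "rgt E = {X. X * E = X}"

lemma block_mult:
  "X \<in> lft E \<Longrightarrow> X * Y \<in> lft E" "Y \<in> rgt E \<Longrightarrow> X * Y \<in> rgt E"
  "X \<in> lft E \<Longrightarrow> E * X = X" "X \<in> lft E \<Longrightarrow> E * (X * Y) = X * Y"
  "Y \<in> rgt E \<Longrightarrow> Y * E = Y" "Y \<in> rgt E \<Longrightarrow> Y * (E * X) = Y * X"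
  by (simp_all add: lft_def rgt_def mult.assoc) (simp_all flip: mult.assoc)

lemma block_orthogonal:
  "X \<in> rgt P \<Longrightarrow> Y \<in> lft Q \<Longrightarrow> X * Y = 0" "X \<in> rgt Q \<Longrightarrow> Y \<in> lft P \<Longrightarrow> X * Y = 0"
proof -
  show "X * Y = 0" if "X \<in> rgt P" "Y \<in> lft Q"
    using block_mult(6)[OF that(1), of Y] PQ(7)[of Y] unfolding block_mult(3)[OF that(2)] by simp
  show "X * Y = 0" if "X \<in> rgt Q" "Y \<in> lft P"
    using block_mult(6)[OF that(1), of Y] PQ(8)[of Y] unfolding block_mult(3)[OF that(2)] by simp
qed

lemma block_orthogonal_assoc:
  "X \<in> rgt P \<Longrightarrow> Y \<in> lft Q \<Longrightarrow> X * (Y * Z) = 0" "X \<in> rgt Q \<Longrightarrow> Y \<in> lft P \<Longrightarrow> X * (Y * Z) = 0"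
  by (simp_all add: block_orthogonal flip: mult.assoc)

lemma block_PQ: "P \<in> lft P" "P \<in> rgt P" "Q \<in> lft Q" "Q \<in> rgt Q"
  by (simp_all add: lft_def rgt_def)

lemmas block = block_mult block_orthogonal block_orthogonal_assoc block_PQ

text \<open>For idempotents this is the block of all of B(X), since the values of \<delta> need not
  lie in \<A>. Membership in \<A> is tracked separately and is automatic only for
  \<open>blk P Q\<close>.\<close>

definition blk :: "'a bop \<Rightarrow> 'a bop \<Rightarrow> 'a bop set" where
  "blk E F = {X. E * X = X \<and> X * F = X}"

lemma blkI: "E * X = X \<Longrightarrow> X * F = X \<Longrightarrow> X \<in> blk E F" by (simp add: blk_def)

lemma blkD:
  assumes "X \<in> blk E F"
  shows "X \<in> lft E" "X \<in> rgt F"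
  using assms by (auto simp: blk_def lft_def rgt_def)

lemma blk_mult: "X \<in> blk E F \<Longrightarrow> Y \<in> blk F' G \<Longrightarrow> X * Y \<in> blk E G"
  unfolding blk_def by (simp add: mult.assoc) (simp flip: mult.assoc)

lemma blk_scale: "X \<in> blk E F \<Longrightarrow> c *\<^sub>C X \<in> blk E F"
  by (simp add: blk_def)

lemma corner_blk: "P * S * Q \<in> blk P Q" "N \<in> blk P Q \<Longrightarrow> N \<in> \<A>"
proof -
  show "P * S * Q \<in> blk P Q" by (simp add: blk_def mult.assoc)
  assume "N \<in> blk P Q"
  then show "N \<in> \<A>" using corner[of N] by (simp add: blk_def Q_def[symmetric] mult.assoc)
qed

lemma blk_PQ: "P \<in> blk P P" "Q \<in> blk Q Q" by (simp_all add: blk_def)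

lemma faithful_left: "(\<And>N. N \<in> blk P Q \<Longrightarrow> T * N = 0) \<Longrightarrow> T * P = 0"
  using corner_faithful_left[OF P(4), of T] corner_blk(1) by (simp add: Q_def)

lemma faithful_right: "(\<And>N. N \<in> blk P Q \<Longrightarrow> N * T = 0) \<Longrightarrow> Q * T = 0"
  using corner_faithful_right[OF P(3), of T] corner_blk(1) by (simp add: Q_def)

lemma faithful_square: "(\<And>N. N \<in> blk P Q \<Longrightarrow> N * T * N = 0) \<Longrightarrow> Q * T * P = 0"
  using corner_square_faithful[of P T] corner_blk(1) by (simp add: Q_def)

lemma commutant_scalar:
  assumes "\<And>N. N \<in> blk P Q \<Longrightarrow> D * N = N * D"
  obtains d where "D * P = d *\<^sub>C P" "Q * D = d *\<^sub>C Q"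
  using corner_commutant_scalar[OF P(3,4), of D] assms corner_blk(1) unfolding Q_def by metis

lemma decompose:
  assumes "A \<in> \<A>"
  obtains a n b where "a \<in> \<A>" "a \<in> blk P P" "n \<in> blk P Q" "b \<in> \<A>" "b \<in> blk Q Q" "A = a + n + b"
proof
  show "P * A * P \<in> \<A>" "Q * A * Q \<in> \<A>" using assms by (simp_all add: closed)
  show "P * A * P \<in> blk P P" "P * A * Q \<in> blk P Q" "Q * A * Q \<in> blk Q Q"
    by (simp_all add: blk_def mult.assoc)
  have "A = (P + Q) * A * (P + Q)" by simp
  also have "\<dots> = P * A * P + P * A * Q + Q * A * Q + Q * A * P"
    by (simp only: distrib_left distrib_right add_ac)
  also have "Q * A * P = 0" using triangular[OF assms] by (simp add: Q_def)
  finally show "A = P * A * P + P * A * Q + Q * A * Q" by simp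
qed

text \<open>Every element of the corner \<open>E \<A> E\<close> is a linear combination of \<open>E\<close> and an invertible element.\<close>

lemma linear_vanishes_on_corner:
  assumes E: "E \<in> \<A>" "E * E = E" and H: "H \<in> linear_maps \<A>"
    and inv: "\<And>S R. S \<in> \<A> \<Longrightarrow> R \<in> \<A> \<Longrightarrow> S \<in> blk E E \<Longrightarrow> R \<in> blk E E \<Longrightarrow> S * R = E \<Longrightarrow> R * S = E \<Longrightarrow> H S = 0"
    and A: "A \<in> \<A>" "A \<in> blk E E"
  shows "H A = 0"
proof -
  obtain c R where c: "c \<noteq> 0" and R: "R \<in> \<A>" "R * (1 - c *\<^sub>C A) = 1" "(1 - c *\<^sub>C A) * R = 1"
    using resolvent A(1) by blast
  have e: "E * A = A" "A * E = A" "E * (E * X) = E * X" for X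
    using A(2) E(2) by (auto simp: blk_def simp flip: mult.assoc)
  let ?S = "E - c *\<^sub>C A"
  have S1: "?S = E * (1 - c *\<^sub>C A)" and S2: "?S = (1 - c *\<^sub>C A) * E"
    by (simp_all add: e right_diff_distrib left_diff_distrib)
  have SE: "?S * E = ?S" "E * ?S = ?S"
    by (simp_all add: e E right_diff_distrib left_diff_distrib)
  \<comment> \<open>As \<open>A\<close> lies in the corner, \<open>E\<close> commutes with
    \<open>1 - c *\<^sub>C A\<close>, so compressing the resolvent to \<open>E * R * E\<close>
    inverts \<open>?S\<close> inside the corner.\<close>
  have "?S * (E * R * E) = (?S * E) * R * E" by (simp only: mult.assoc)
  also have "\<dots> = E * ((1 - c *\<^sub>C A) * R) * E" by (subst SE(1), subst S1) (simp only: mult.assoc)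
  finally have SR: "?S * (E * R * E) = E" by (simp add: R E)
  have "E * R * E * ?S = E * R * (E * ?S)" by (simp only: mult.assoc)
  also have "\<dots> = E * (R * (1 - c *\<^sub>C A)) * E" by (subst SE(2), subst S2) (simp only: mult.assoc)
  finally have RS: "E * R * E * ?S = E" by (simp add: R E)
  have "H ?S = 0"
  proof (rule inv[OF _ _ _ _ SR RS])
    show "?S \<in> blk E E" "E * R * E \<in> blk E E"
      using SE by (simp_all add: blk_def mult.assoc e E)
  qed (use A R E in \<open>simp_all add: closed\<close>)
  moreover have "H E = 0" by (rule inv[of E E]) (use E in \<open>simp_all add: blk_def\<close>)
  moreover have "H ?S = H E + (- c) *\<^sub>C H A"
    using linear_maps_add[OF H E(1), of "(- c) *\<^sub>C A"] linear_maps_scale[OF H A(1), of "- c"] A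
    by (simp add: closed)
  ultimately show ?thesis using c by simp
qed

end

section \<open>Identities forced by Jordan derivability at one point\<close>

locale jordan_point = corner_algebra +
  fixes \<delta> C
  assumes derivable: "jordan_derivable_at \<A> C \<delta>"
begin

lemma linear: "\<delta> \<in> linear_maps \<A>" and C: "C \<in> \<A>"
  and derivable_eq: "A \<in> \<A> \<Longrightarrow> B \<in> \<A> \<Longrightarrow> A * B = C \<Longrightarrow> jordan_defect \<delta> A B = 0"
  using derivable by (auto simp: jordan_derivable_at_def jordan_defect_def)

lemmas d_add = linear_maps_add[OF linear] and d_scale = linear_maps_scale[OF linear]

lemma d_zero: "\<delta> 0 = 0"
  using d_add[OF zero zero] by simp

abbreviation \<Phi> where "\<Phi> \<equiv> jordan_defect \<delta>"

lemma defect_sym: "\<Phi> A B = \<Phi> B A"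
  by (simp add: jordan_defect_def add_ac)

lemma defect_linear: "B \<in> \<A> \<Longrightarrow> (\<lambda>A. \<Phi> A B) \<in> linear_maps \<A>"
  by (simp add: linear_maps_def jordan_defect_def d_add d_scale closed algebra_simps)

lemma defect_add: "A \<in> \<A> \<Longrightarrow> A' \<in> \<A> \<Longrightarrow> B \<in> \<A> \<Longrightarrow> \<Phi> (A + A') B = \<Phi> A B + \<Phi> A' B"
  and defect_scale: "A \<in> \<A> \<Longrightarrow> B \<in> \<A> \<Longrightarrow> \<Phi> (c *\<^sub>C A) B = c *\<^sub>C \<Phi> A B"
  using linear_maps_add[OF defect_linear] linear_maps_scale[OF defect_linear] by auto

lemma defect_add': "A \<in> \<A> \<Longrightarrow> A' \<in> \<A> \<Longrightarrow> B \<in> \<A> \<Longrightarrow> \<Phi> B (A + A') = \<Phi> B A + \<Phi> B A'"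
  and defect_scale': "A \<in> \<A> \<Longrightarrow> B \<in> \<A> \<Longrightarrow> \<Phi> B (c *\<^sub>C A) = c *\<^sub>C \<Phi> B A"
  using defect_add defect_scale by (simp_all add: defect_sym[of B])

lemma defect_diff': "A \<in> \<A> \<Longrightarrow> A' \<in> \<A> \<Longrightarrow> B \<in> \<A> \<Longrightarrow> \<Phi> B (A - A') = \<Phi> B A - \<Phi> B A'"
  by (simp only: diff_eq defect_scale' defect_add' scale)

lemmas bilin = defect_add defect_scale defect_add' defect_scale' defect_diff' closed


lemma Q_triangular: "A \<in> \<A> \<Longrightarrow> Q * (A * P) = 0"
  using triangular[of A] by (simp add: Q_def mult.assoc)

text \<open>Here \<open>(S + N + QCT') (S'PC - S'NT + T) = PC + QC = C\<close>.\<close>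

lemma factorization:
  assumes "S \<in> \<A>" "S' \<in> \<A>" "T \<in> \<A>" "T' \<in> \<A>"
    and "S \<in> blk P P" "S' \<in> blk P P" "T \<in> blk Q Q" "T' \<in> blk Q Q" "N \<in> blk P Q"
    and "S * S' = P" "T' * T = Q"
  shows "\<Phi> (S + N + Q * C * T') (S' * (P * C) - S' * N * T + T) = 0"
proof (rule derivable_eq)
  note e = assms(5-9)[THEN blkD(1)] assms(5-9)[THEN blkD(2)]
  have SS: "S * (S' * X) = P * X" and TT: "T' * (T * X) = Q * X" for X
    using assms(10,11) by (simp_all flip: mult.assoc)
  \<comment> \<open>The lower left block of \<open>C\<close> vanishes, so
    \<open>Q C T' T = Q C Q\<close> recovers all of \<open>Q C\<close>.\<close>
  have CQ: "Q * (C * Q) = Q * C"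
  proof -
    have "C * Q = C - C * P" by (simp add: Q_def right_diff_distrib)
    then show ?thesis using Q_triangular[OF C] by (simp add: right_diff_distrib)
  qed
  show "(S + N + Q * C * T') * (S' * (P * C) - S' * N * T + T) = C"
    using distrib_right[of P Q C, symmetric]
    by (simp add: distrib_left distrib_right left_diff_distrib right_diff_distrib mult.assoc
        e SS TT assms(10,11) CQ block)
  show "S + N + Q * C * T' \<in> \<A>" "S' * (P * C) - S' * N * T + T \<in> \<A>"
    using assms(1-4) corner_blk(2)[OF assms(9)] C by (simp_all add: closed)
qed

text \<open>Bilinear expansion sorted into the shape required by \<open>coefficients_zero\<close>,
  with \<open>r\<close> in the role of the inverse of \<open>s\<close>.\<close>

lemma defect_expand:
  assumes "S \<in> \<A>" "N \<in> \<A>" "V \<in> \<A>" "W \<in> \<A>" "M \<in> \<A>" "T \<in> \<A>" and rs: "r * s = 1"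
  shows "\<Phi> (s *\<^sub>C S + n *\<^sub>C N + V) (r *\<^sub>C W - (r * n) *\<^sub>C M + T) =
    (\<Phi> S W + \<Phi> V T) + n *\<^sub>C (\<Phi> N T - \<Phi> S M) + s *\<^sub>C \<Phi> S T +
    r *\<^sub>C (\<Phi> V W + n *\<^sub>C (\<Phi> N W - \<Phi> V M) + (n * n) *\<^sub>C (- \<Phi> N M))"
proof -
  have sr: "s * r = 1" using rs by (simp add: mult.commute)
  have srn: "s * (r * n) = n" by (simp add: sr flip: mult.assoc)
  have scal: "s *\<^sub>C r *\<^sub>C X = X" "s *\<^sub>C (r * n) *\<^sub>C X = n *\<^sub>C X"
      "n *\<^sub>C r *\<^sub>C X = r *\<^sub>C n *\<^sub>C X" "n *\<^sub>C (r * n) *\<^sub>C X = r *\<^sub>C (n * n) *\<^sub>C X" for X :: "'a bop"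
    by (simp_all only: scaleC_scaleC sr srn scaleC_one) (simp_all only: mult_ac)
  have "\<Phi> (s *\<^sub>C S + n *\<^sub>C N + V) (r *\<^sub>C W - (r * n) *\<^sub>C M + T) =
      (s *\<^sub>C (r *\<^sub>C \<Phi> S W - (r * n) *\<^sub>C \<Phi> S M + \<Phi> S T) +
       n *\<^sub>C (r *\<^sub>C \<Phi> N W - (r * n) *\<^sub>C \<Phi> N M + \<Phi> N T)) +
      (r *\<^sub>C \<Phi> V W - (r * n) *\<^sub>C \<Phi> V M + \<Phi> V T)"
  proof -
    have right: "\<Phi> X (r *\<^sub>C W - (r * n) *\<^sub>C M + T) = r *\<^sub>C \<Phi> X W - (r * n) *\<^sub>C \<Phi> X M + \<Phi> X T"
      if "X \<in> \<A>" for X using that assms(1-6) by (simp add: bilin)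
    have left: "\<Phi> (s *\<^sub>C S + n *\<^sub>C N + V) Y = s *\<^sub>C \<Phi> S Y + n *\<^sub>C \<Phi> N Y + \<Phi> V Y"
      if "Y \<in> \<A>" for Y using that assms(1-6) by (simp add: bilin)
    have "r *\<^sub>C W - (r * n) *\<^sub>C M + T \<in> \<A>" using assms(1-6) by (simp add: closed)
    then show ?thesis by (simp only: left right[OF assms(1)] right[OF assms(2)] right[OF assms(3)])
  qed
  then show ?thesis
    by (simp only: scaleC_add_right complex_vector.scale_right_diff_distrib
        complex_vector.scale_minus_right scal)
      (simp only: diff_conv_add_uminus minus_add_distrib minus_minus add_ac
        flip: scaleC_scaleC[of r n])
qed

text \<open>The factorization persists when \<open>S\<close>, \<open>S'\<close>, \<open>N\<close>
  become \<open>s S\<close>, \<open>S' / s\<close>, \<open>n N\<close>. Only \<open>?W\<close> and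
  \<open>?V\<close> contain \<open>C\<close>, and neither occurs in the three coefficients that
  \<open>coefficients_zero\<close> isolates.\<close>

lemma defect_coefficients:
  assumes S: "S \<in> \<A>" "S' \<in> \<A>" and T: "T \<in> \<A>" "T' \<in> \<A>"
    and blk: "S \<in> blk P P" "S' \<in> blk P P" "T \<in> blk Q Q" "T' \<in> blk Q Q" "N \<in> blk P Q"
    and inv: "S * S' = P" "T' * T = Q"
  shows "\<Phi> S T = 0" "\<Phi> N T = \<Phi> S (S' * N * T)" "\<Phi> N (S' * N * T) = 0"
proof -
  let ?W = "S' * (P * C)" and ?M = "S' * N * T" and ?V = "Q * C * T'"
  note N = corner_blk(2)[OF blk(5)]
  have *: "(\<Phi> S ?W + \<Phi> ?V T) + n *\<^sub>C (\<Phi> N T - \<Phi> S ?M) + s *\<^sub>C \<Phi> S T +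
      inverse s *\<^sub>C (\<Phi> ?V ?W + n *\<^sub>C (\<Phi> N ?W - \<Phi> ?V ?M) + (n * n) *\<^sub>C (- \<Phi> N ?M)) = 0"
    if "s \<noteq> 0" for s n
  proof -
    have "\<Phi> (s *\<^sub>C S + n *\<^sub>C N + ?V)
        (inverse s *\<^sub>C S' * (P * C) - inverse s *\<^sub>C S' * (n *\<^sub>C N) * T + T) = 0"
      by (rule factorization) (use assms that in \<open>simp_all add: closed blk_scale scaleC_scaleC scaleC_one\<close>)
    then have "\<Phi> (s *\<^sub>C S + n *\<^sub>C N + ?V)
        (inverse s *\<^sub>C ?W - (inverse s * n) *\<^sub>C ?M + T) = 0"
      by (simp add: scaleC_scaleC mult.commute)
    then show ?thesis
      using defect_expand[of S N ?V ?W ?M T "inverse s" s n] that S T N C by (simp add: closed)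
  qed
  show "\<Phi> S T = 0" "\<Phi> N T = \<Phi> S ?M" "\<Phi> N ?M = 0"
    using coefficients_zero[OF *] by simp_all
qed

lemma linear_maps_diff:
  assumes "f \<in> linear_maps \<A>" "g \<in> linear_maps \<A>"
  shows "(\<lambda>A. f A - g A) \<in> linear_maps \<A>"
  using assms by (simp add: linear_maps_def complex_vector.scale_right_diff_distrib algebra_simps)

lemma linear_maps_comp_mult:
  assumes "f \<in> linear_maps \<A>" "N \<in> \<A>"
  shows "(\<lambda>A. f (A * N)) \<in> linear_maps \<A>" "(\<lambda>A. f (N * A)) \<in> linear_maps \<A>"
  using assms by (simp_all add: linear_maps_def distrib_left distrib_right closed)

text \<open>Known for invertible arguments; linearity extends it in one variable at a time.\<close>

lemma defect_diagonal:
  assumes A: "A \<in> \<A>" "A \<in> blk P P" and B: "B \<in> \<A>" "B \<in> blk Q Q"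
  shows "\<Phi> A B = 0"
proof (rule linear_vanishes_on_corner[OF P(1,2) defect_linear[OF B(1)] _ A])
  fix S S' assume S: "S \<in> \<A>" "S' \<in> \<A>" "S \<in> blk P P" "S' \<in> blk P P" "S * S' = P"
  have "\<Phi> B S = 0"
  proof (rule linear_vanishes_on_corner[OF Q PQ(2) defect_linear[OF S(1)] _ B])
    fix T T' assume "T \<in> \<A>" "T' \<in> \<A>" "T \<in> blk Q Q" "T' \<in> blk Q Q" "T' * T = Q"
    then show "\<Phi> T S = 0"
      using defect_coefficients(1)[OF S(1,2) _ _ S(3,4) _ _ _ S(5), of T T' 0]
      by (simp add: defect_sym blk_def)
  qed
  then show "\<Phi> S B = 0" by (simp only: defect_sym)
qed

text \<open>Putting \<open>S * N\<close> for \<open>N\<close> in the second coefficient identity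
  removes the inverse of \<open>S\<close>. Both sides become linear in each diagonal argument, so
  the passage from invertible elements applies.\<close>

lemma defect_balanced:
  assumes A: "A \<in> \<A>" "A \<in> blk P P" and B: "B \<in> \<A>" "B \<in> blk Q Q" and N: "N \<in> blk P Q"
  shows "\<Phi> (A * N) B = \<Phi> A (N * B)"
proof -
  note NA = corner_blk(2)[OF N]
  have lin1: "(\<lambda>A. \<Phi> (A * N) B - \<Phi> A (N * B)) \<in> linear_maps \<A>"
    using NA B by (intro linear_maps_diff linear_maps_comp_mult(1)[OF defect_linear] defect_linear)
      (auto simp: closed)
  have "\<Phi> (A * N) B - \<Phi> A (N * B) = 0"
  proof (rule linear_vanishes_on_corner[OF P(1,2) lin1 _ A])
    fix S S' assume S: "S \<in> \<A>" "S' \<in> \<A>" "S \<in> blk P P" "S' \<in> blk P P" "S * S' = P" "S' * S = P"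
    have lin2: "(\<lambda>B. \<Phi> B (S * N) - \<Phi> (N * B) S) \<in> linear_maps \<A>"
      using NA S by (intro linear_maps_diff linear_maps_comp_mult(2)[OF defect_linear] defect_linear)
        (auto simp: closed)
    have "\<Phi> B (S * N) - \<Phi> (N * B) S = 0"
    proof (rule linear_vanishes_on_corner[OF Q PQ(2) lin2 _ B])
      fix T T' assume T: "T \<in> \<A>" "T' \<in> \<A>" "T \<in> blk Q Q" "T' \<in> blk Q Q" "T' * T = Q"
      have "S' * (S * N) = N" using S(6) N by (simp add: blk_def flip: mult.assoc)
      then show "\<Phi> T (S * N) - \<Phi> (N * T) S = 0"
        using defect_coefficients(2)[OF S(1,2) T(1,2) S(3,4) T(3,4) blk_mult[OF S(3) N] S(5) T(5)]
        by (simp add: defect_sym[of T] defect_sym[of _ S])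
    qed
    then show "\<Phi> (S * N) B - \<Phi> S (N * B) = 0"
      by (simp add: defect_sym[of B] defect_sym[of _ S])
  qed
  then show ?thesis by simp
qed

text \<open>The third coefficient identity with \<open>S = P\<close> and
  \<open>T = Q\<close>.\<close>

lemma defect_corner_self:
  assumes "N \<in> blk P Q"
  shows "\<Phi> N N = 0"
  using defect_coefficients(3)[OF P(1) P(1) Q Q blk_PQ(1) blk_PQ(1) blk_PQ(2) blk_PQ(2) assms PQ(1,2)]
    assms by (simp add: blk_def)

end

section \<open>Maps for which \<open>\<delta> P\<close> is block diagonal\<close>

locale jordan_point_normalized = jordan_point +
  assumes normalized: "P * \<delta> P * Q = 0" "Q * \<delta> P * P = 0"
begin

lemma defectD:
  "\<Phi> A B = 0 \<Longrightarrow> \<delta> (A * B + B * A) = \<delta> A * B + A * \<delta> B + \<delta> B * A + B * \<delta> A"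
  by (simp add: jordan_defect_def)

lemma blk_split: "X = P * X * P + P * X * Q + Q * X * P + Q * X * Q"
proof -
  have "X = (P + Q) * X * (P + Q)" by simp
  then show ?thesis by (simp only: distrib_left distrib_right add_ac)
qed

lemma sandwich: "X = Y \<Longrightarrow> E * X * F = E * Y * F" for X Y E F :: "'a bop"
  by simp

text \<open>Since \<open>P Q = Q P = 0\<close>, the identity \<open>\<Phi> P Q = 0\<close> makes the
  off-diagonal blocks of \<open>\<delta> P\<close> and \<open>\<delta> Q\<close> cancel.\<close>

lemma d_Q_blocks: "P * \<delta> Q * Q = 0" "Q * \<delta> Q * P = 0"
proof -
  have *: "\<delta> P * Q + P * \<delta> Q + \<delta> Q * P + Q * \<delta> P = 0"
    using defectD[OF defect_diagonal[OF P(1) blk_PQ(1) Q blk_PQ(2)]] by (simp add: d_zero)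
  show "P * \<delta> Q * Q = 0" "Q * \<delta> Q * P = 0"
    using sandwich[OF *, of P Q] sandwich[OF *, of Q P] normalized
    by (simp_all add: distrib_left distrib_right mult.assoc)
qed

text \<open>The blocks of \<open>\<Phi> A Q = 0\<close> are read off: as \<open>\<delta> Q\<close>
  is block diagonal, the off-diagonal ones give those of \<open>\<delta> A\<close>, and the lower
  right one is \<open>Q * \<delta> A * Q\<close> taken twice.\<close>

lemma d_diagonal_P:
  assumes A: "A \<in> \<A>" "A \<in> blk P P"
  shows "\<delta> A \<in> blk P P"
proof -
  note e = blkD[OF A(2)]
  have "\<delta> A * Q + A * \<delta> Q + \<delta> Q * A + Q * \<delta> A = 0"
    using defectD[OF defect_diagonal[OF A Q blk_PQ(2)]] by (simp add: d_zero e block)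
  note * = sandwich[OF this]
  have A': "A * (\<delta> Q * Q) = 0" "Q * (\<delta> Q * A) = 0"
  proof -
    have "A * (\<delta> Q * Q) = A * (P * \<delta> Q * Q)" "Q * (\<delta> Q * A) = Q * \<delta> Q * P * A"
      by (simp_all add: mult.assoc e block del: PQ)
    then show "A * (\<delta> Q * Q) = 0" "Q * (\<delta> Q * A) = 0"
      by (simp_all only: d_Q_blocks mult_zero_left mult_zero_right)
  qed
  have "P * \<delta> A * Q = 0" "Q * \<delta> A * P = 0"
    using *[of P Q] *[of Q P] A' by (simp_all add: distrib_left distrib_right mult.assoc e block)
  moreover have "Q * \<delta> A * Q = 0"
    by (rule vec_double) (use *[of Q Q] A' in \<open>simp add: distrib_left distrib_right mult.assoc e block\<close>)
  ultimately have "\<delta> A = P * \<delta> A * P"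
    using blk_split[of "\<delta> A"] by simp
  then show ?thesis by (metis PQ(1) blkI mult.assoc)
qed

lemma d_diagonal_Q:
  assumes B: "B \<in> \<A>" "B \<in> blk Q Q"
  shows "\<delta> B \<in> blk Q Q"
proof -
  note e = blkD[OF B(2)]
  have "\<delta> P * B + P * \<delta> B + \<delta> B * P + B * \<delta> P = 0"
    using defectD[OF defect_diagonal[OF P(1) blk_PQ(1) B]] by (simp add: d_zero e block)
  note * = sandwich[OF this]
  have B': "B * (\<delta> P * P) = 0" "P * (\<delta> P * B) = 0"
  proof -
    have "B * (\<delta> P * P) = B * (Q * \<delta> P * P)" "P * (\<delta> P * B) = P * \<delta> P * Q * B"
      by (simp_all add: mult.assoc e block del: PQ)
    then show "B * (\<delta> P * P) = 0" "P * (\<delta> P * B) = 0"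
      by (simp_all only: normalized mult_zero_left mult_zero_right)
  qed
  have "P * \<delta> B * Q = 0" "Q * \<delta> B * P = 0"
    using *[of P Q] *[of Q P] B' by (simp_all add: distrib_left distrib_right mult.assoc e block)
  moreover have "P * \<delta> B * P = 0"
    by (rule vec_double) (use *[of P P] B' in \<open>simp add: distrib_left distrib_right mult.assoc e block\<close>)
  ultimately have "\<delta> B = Q * \<delta> B * Q"
    using blk_split[of "\<delta> B"] by simp
  then show ?thesis by (metis PQ(2) blkI mult.assoc)
qed

lemmas d_PQ = blkD[OF d_diagonal_P[OF P(1) blk_PQ(1)]] blkD[OF d_diagonal_Q[OF Q blk_PQ(2)]]

lemma d_corner:
  assumes N: "N \<in> blk P Q"
  shows "\<delta> N \<in> blk P Q"
proof -
  have diag: "P * \<delta> N * P = 0 \<and> Q * \<delta> N * Q = 0" if N: "N \<in> blk P Q" for N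
  proof -
    note NA = corner_blk(2)[OF N]
    note e = blkD[OF N] d_PQ
    \<comment> \<open>The term \<open>\<delta> N\<close> is common to both sides. On the left,
      \<open>\<delta> N\<close> is then multiplied by \<open>Q\<close>, on the right by
      \<open>P\<close>, so each diagonal block appears twice on one side and not on the
      other.\<close>
    have "\<Phi> N Q = \<Phi> P N"
      using defect_balanced[OF P(1) blk_PQ(1) Q blk_PQ(2) N] by (simp add: e block)
    then have "- \<Phi> N Q = - \<Phi> P N" by simp
    then have "\<delta> N * Q + N * \<delta> Q + Q * \<delta> N = \<delta> P * N + P * \<delta> N + \<delta> N * P"
      by (simp add: jordan_defect_def e block)
    note * = sandwich[OF this]
    have "P * \<delta> N * P + P * \<delta> N * P = 0" "Q * \<delta> N * Q + Q * \<delta> N * Q = 0"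
      using *[of P P] *[of Q Q] by (simp_all add: distrib_left distrib_right mult.assoc e block)
    then show ?thesis using vec_double by blast
  qed
  have "Q * \<delta> N * P = 0" if N: "N \<in> blk P Q" for N
  proof -
    have "M * \<delta> N * M = 0" if M: "M \<in> blk P Q" for M
    proof -
      note e = blkD[OF M] blkD[OF N] and in\<A> = corner_blk(2)[OF M] corner_blk(2)[OF N]
      \<comment> \<open>Polarisation of the vanishing of \<Phi> on the diagonal of the
        corner.\<close>
      have "\<Phi> (M + N) (M + N) = 0"
        using M N by (intro defect_corner_self) (simp add: blk_def distrib_left distrib_right)
      then have "\<Phi> M N + \<Phi> M N = 0"
        using in\<A> by (simp add: bilin defect_corner_self M N defect_sym[of N M])
      from defectD[OF vec_double[OF this]]
      have "\<delta> M * N + M * \<delta> N + \<delta> N * M + N * \<delta> M = 0"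
        by (simp add: e block d_zero)
      from sandwich[OF this, of P M] have 1: "M * (\<delta> N * M) + N * (\<delta> M * M) = 0"
        by (simp add: distrib_left distrib_right mult.assoc e block)
      have "(\<delta> M * M + M * \<delta> M) + (\<delta> M * M + M * \<delta> M) = 0"
        using defectD[OF defect_corner_self[OF M]] by (simp add: e block d_zero add_ac)
      then have "\<delta> M * M + M * \<delta> M = 0" by (rule vec_double)
      \<comment> \<open>Multiplication by \<open>N\<close> from the left kills
        \<open>M * \<delta> M\<close>, as \<open>N M = 0\<close>; this removes the second term of
        the polarised identity.\<close>
      from sandwich[OF this, of N Q] have "N * (\<delta> M * M) = 0"
        by (simp add: distrib_left distrib_right mult.assoc e block)
      with 1 show ?thesis by (simp add: mult.assoc)
    qed
    then show ?thesis by (rule faithful_square)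
  qed
  then have "\<delta> N = P * \<delta> N * Q"
    using blk_split[of "\<delta> N"] diag[OF N] N by simp
  then show ?thesis by (metis PQ(1,2) blkI mult.assoc)
qed

lemma d_one: "\<delta> 1 = \<delta> P + \<delta> Q"
  using d_add[OF P(1) Q] by simp

text \<open>Once \<open>\<delta> N\<close> lies in the corner,
  \<open>\<Phi> N Q = \<Phi> P N\<close> reduces to
  \<open>N * \<delta> Q = \<delta> P * N\<close>.\<close>

lemma d_one_commutes:
  assumes N: "N \<in> blk P Q"
  shows "\<delta> 1 * N = N * \<delta> 1"
proof -
  note e = blkD[OF N] blkD[OF d_corner[OF N]] d_PQ
  have "\<Phi> N Q = \<Phi> P N"
    using defect_balanced[OF P(1) blk_PQ(1) Q blk_PQ(2) N] by (simp add: e block)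
  then have "N * \<delta> Q = \<delta> P * N"
    by (simp add: jordan_defect_def e block)
  then show ?thesis by (simp add: d_one distrib_left distrib_right e block)
qed

lemma d_one_zero: "\<delta> 1 = 0"
proof -
  obtain d where d: "\<delta> 1 * P = d *\<^sub>C P" "Q * \<delta> 1 = d *\<^sub>C Q"
    using commutant_scalar[OF d_one_commutes] by blast
  have dP: "\<delta> P = d *\<^sub>C P" and dQ: "\<delta> Q = d *\<^sub>C Q"
    using d by (simp_all add: d_one distrib_left distrib_right d_PQ block)
  have d1: "\<delta> 1 = d *\<^sub>C 1"
    by (simp add: d_one dP dQ flip: scaleC_add_right)
  \<comment> \<open>For \<open>C = 0\<close> the factorization \<open>1 * C\<close> carries no
    information; \<open>N * P = 0\<close> does, because \<open>P * N = N\<close> is the reversed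
    product.\<close>
  have "d = 0"
  proof (cases "C = 0")
    case True
    have "N = 0" if N: "N \<in> blk P Q" "d \<noteq> 0" for N
    proof -
      note e = blkD[OF N(1)] blkD[OF d_corner[OF N(1)]]
      have "\<delta> N = \<delta> N + d *\<^sub>C N"
        using defectD[OF derivable_eq[OF corner_blk(2)[OF N(1)] P(1)]]
        by (simp add: True e block dP)
      then show ?thesis using N(2) by simp
    qed
    \<comment> \<open>A nonzero \<open>d\<close> would annihilate the whole corner, which acts
      faithfully.\<close>
    then have "d \<noteq> 0 \<Longrightarrow> P * P = 0" using faithful_left[of P] by fastforce
    then show ?thesis using P(3) by auto
  next
    case False
    have "d *\<^sub>C C + d *\<^sub>C C = 0"
      using defectD[OF derivable_eq[OF one C]] d_add[OF C C] by (simp add: d1 algebra_simps)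
    then have "d *\<^sub>C C = 0" by (rule vec_double)
    then show ?thesis using False by simp
  qed
  then show ?thesis using d1 by simp
qed

lemma dPQ_zero: "\<delta> P = 0" "\<delta> Q = 0"
proof -
  have "P * \<delta> 1 = \<delta> P" "Q * \<delta> 1 = \<delta> Q"
    by (simp_all add: d_one distrib_left d_PQ block)
  then show "\<delta> P = 0" "\<delta> Q = 0" by (simp_all add: d_one_zero)
qed

text \<open>As \<open>\<delta> Q = 0\<close> and \<delta> preserves the corner,
  \<open>\<Phi> (A * N) Q\<close> vanishes. So does \<open>\<Phi> A N\<close>, which on these blocks
  is the defect of the product rule.\<close>

lemma d_mult_left:
  assumes A: "A \<in> \<A>" "A \<in> blk P P" and N: "N \<in> blk P Q"
  shows "\<delta> (A * N) = \<delta> A * N + A * \<delta> N"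
proof -
  note e = blkD[OF A(2)] blkD[OF d_diagonal_P[OF A]] blkD[OF N] blkD[OF d_corner[OF N]]
    blkD[OF d_corner[OF blk_mult[OF A(2) N]]]
  have "\<Phi> (A * N) Q = \<Phi> A N"
    using defect_balanced[OF A Q blk_PQ(2) N] by (simp add: e block)
  then show ?thesis
    by (simp add: jordan_defect_def e block mult.assoc dPQ_zero)
qed

lemma d_mult_right:
  assumes B: "B \<in> \<A>" "B \<in> blk Q Q" and N: "N \<in> blk P Q"
  shows "\<delta> (N * B) = \<delta> N * B + N * \<delta> B"
proof -
  note e = blkD[OF B(2)] blkD[OF d_diagonal_Q[OF B]] blkD[OF N] blkD[OF d_corner[OF N]]
    blkD[OF d_corner[OF blk_mult[OF N B(2)]]]
  have "\<Phi> N B = \<Phi> P (N * B)"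
    using defect_balanced[OF P(1) blk_PQ(1) B N] by (simp add: e block)
  then show ?thesis
    by (simp add: jordan_defect_def e block mult.assoc dPQ_zero)
qed

text \<open>Expanding \<delta> on \<open>A B N\<close> as \<open>(A B) N\<close> and as
  \<open>A (B N)\<close> shows that the defect of the product rule annihilates the corner from the
  left.\<close>

lemma d_mult_P:
  assumes A: "A \<in> \<A>" "A \<in> blk P P" and B: "B \<in> \<A>" "B \<in> blk P P"
  shows "\<delta> (A * B) = \<delta> A * B + A * \<delta> B"
proof -
  note AB = mult[OF A(1) B(1)] blk_mult[OF A(2) B(2)]
  note e = blkD[OF A(2)] blkD[OF d_diagonal_P[OF A]] blkD[OF B(2)] blkD[OF d_diagonal_P[OF B]]
    blkD[OF d_diagonal_P[OF AB]]
  have "(\<delta> (A * B) - \<delta> A * B - A * \<delta> B) * P = 0"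
  proof (rule faithful_left)
    fix N assume N: "N \<in> blk P Q"
    have "\<delta> (A * B) * N + A * B * \<delta> N = \<delta> A * (B * N) + A * (\<delta> B * N + B * \<delta> N)"
      using d_mult_left[OF AB N] d_mult_left[OF A blk_mult[OF B(2) N]] d_mult_left[OF B N]
      by (simp add: mult.assoc)
    then show "(\<delta> (A * B) - \<delta> A * B - A * \<delta> B) * N = 0"
      by (simp add: algebra_simps)
  qed
  then show ?thesis by (simp add: left_diff_distrib mult.assoc e block diff_eq_eq add.commute)
qed

lemma d_mult_Q:
  assumes A: "A \<in> \<A>" "A \<in> blk Q Q" and B: "B \<in> \<A>" "B \<in> blk Q Q"
  shows "\<delta> (A * B) = \<delta> A * B + A * \<delta> B"
proof -
  note AB = mult[OF A(1) B(1)] blk_mult[OF A(2) B(2)]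
  note e = blkD[OF A(2)] blkD[OF d_diagonal_Q[OF A]] blkD[OF B(2)] blkD[OF d_diagonal_Q[OF B]]
    blkD[OF d_diagonal_Q[OF AB]]
  have "Q * (\<delta> (A * B) - \<delta> A * B - A * \<delta> B) = 0"
  proof (rule faithful_right)
    fix N assume N: "N \<in> blk P Q"
    have "\<delta> N * (A * B) + N * \<delta> (A * B) = (\<delta> N * A + N * \<delta> A) * B + (N * A) * \<delta> B"
      using d_mult_right[OF AB N] d_mult_right[OF B blk_mult[OF N A(2)]] d_mult_right[OF A N]
      by (simp add: mult.assoc)
    then show "N * (\<delta> (A * B) - \<delta> A * B - A * \<delta> B) = 0"
      by (simp add: algebra_simps)
  qed
  then show ?thesis by (simp add: right_diff_distrib mult.assoc e block diff_eq_eq add.commute)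
qed

lemma derivation: "derivation_on \<A> \<delta>"
  unfolding derivation_on_def
proof (intro conjI ballI linear)
  fix A A' assume "A \<in> \<A>" "A' \<in> \<A>"
  obtain a n b where A: "a \<in> \<A>" "a \<in> blk P P" "n \<in> blk P Q" "b \<in> \<A>" "b \<in> blk Q Q" "A = a + n + b"
    using decompose[OF \<open>A \<in> \<A>\<close>] .
  obtain a' n' b' where A': "a' \<in> \<A>" "a' \<in> blk P P" "n' \<in> blk P Q" "b' \<in> \<A>" "b' \<in> blk Q Q"
      "A' = a' + n' + b'"
    using decompose[OF \<open>A' \<in> \<A>\<close>] .
  note in\<A> = A(1,4) A'(1,4) corner_blk(2)[OF A(3)] corner_blk(2)[OF A'(3)]
  note e = A(2,3,5)[THEN blkD(1)] A(2,3,5)[THEN blkD(2)] A'(2,3,5)[THEN blkD(1)] A'(2,3,5)[THEN blkD(2)]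
    blkD[OF d_diagonal_P[OF A(1,2)]] blkD[OF d_diagonal_P[OF A'(1,2)]] blkD[OF d_corner[OF A(3)]]
    blkD[OF d_corner[OF A'(3)]] blkD[OF d_diagonal_Q[OF A(4,5)]] blkD[OF d_diagonal_Q[OF A'(4,5)]]
  \<comment> \<open>Of the nine block products only these four survive; those involving values of
    \<delta> vanish by the same pattern, as \<delta> preserves blocks.\<close>
  have prod: "A * A' = a * a' + a * n' + n * b' + b * b'"
    by (simp add: A(6) A'(6) distrib_left distrib_right e block add_ac)
  have "\<delta> (A * A') = \<delta> (a * a') + \<delta> (a * n') + \<delta> (n * b') + \<delta> (b * b')"
    unfolding prod using in\<A> by (simp add: d_add closed)
  also have "\<dots> = (\<delta> a + \<delta> n + \<delta> b) * (a' + n' + b') + (a + n + b) * (\<delta> a' + \<delta> n' + \<delta> b')"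
    by (simp add: d_mult_P[OF A(1,2) A'(1,2)] d_mult_left[OF A(1,2) A'(3)] d_mult_right[OF A'(4,5) A(3)]
        d_mult_Q[OF A(4,5) A'(4,5)] distrib_left distrib_right e block add_ac)
  also have "\<dots> = \<delta> A * A' + A * \<delta> A'"
    using in\<A> by (simp add: A(6) A'(6) d_add closed)
  finally show "\<delta> (A * A') = \<delta> A * A' + A * \<delta> A'" .
qed

end

section \<open>Reduction to the normalized case\<close>

context jordan_point
begin

text \<open>The inner derivation by \<open>U\<close> has the same off-diagonal blocks at \<open>P\<close> as \<open>\<delta>\<close>.\<close>

lemma derivation: "derivation_on \<A> \<delta>"
proof -
  \<comment> \<open>The commutator \<open>P U - U P\<close> has off-diagonal blocks
    \<open>P U Q\<close> and \<open>- Q U P\<close>, hence the minus sign.\<close>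
  define U where "U = P * \<delta> P * Q - Q * \<delta> P * P"
  define \<epsilon> where "\<epsilon> A = \<delta> A - (A * U - U * A)" for A
  have lin: "\<epsilon> \<in> linear_maps \<A>"
    by (simp add: linear_maps_def \<epsilon>_def d_add d_scale distrib_left distrib_right
        complex_vector.scale_right_diff_distrib algebra_simps)
  \<comment> \<open>Inner derivations satisfy the Jordan identity everywhere, so subtracting one
    preserves derivability at \<open>C\<close>.\<close>
  have "\<delta> (A * B + B * A) = \<delta> A * B + A * \<delta> B + \<delta> B * A + B * \<delta> A \<Longrightarrow>
      \<epsilon> (A * B + B * A) = \<epsilon> A * B + A * \<epsilon> B + \<epsilon> B * A + B * \<epsilon> A" for A B
    by (simp add: \<epsilon>_def algebra_simps)
  then have "jordan_derivable_at \<A> C \<epsilon>"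
    using derivable lin unfolding jordan_derivable_at_def by blast
  moreover have "P * \<epsilon> P * Q = 0" "Q * \<epsilon> P * P = 0"
    by (simp_all add: \<epsilon>_def U_def algebra_simps)
  ultimately interpret \<epsilon>: jordan_point_normalized \<A> P \<epsilon> C
    by unfold_locales (simp_all add: Q_def)
  have "\<epsilon> (A * B) = \<epsilon> A * B + A * \<epsilon> B \<Longrightarrow> \<delta> (A * B) = \<delta> A * B + A * \<delta> B" for A B
    by (simp add: \<epsilon>_def algebra_simps)
  then show ?thesis
    using \<epsilon>.derivation linear by (simp add: derivation_on_def)
qed

end

section \<open>Application to the algebra of a subspace lattice\<close>

lemma corner_algebra_alg:
  fixes \<L> :: "'a::complex_banach set set" and P :: "'a bop"
  assumes \<L>: "subspace_lattice \<L>"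
    and P: "P \<in> alg \<L>" "P * P = P" "P \<noteq> 0" "P \<noteq> 1"
    and ran: "range (bop_apply P) \<in> \<L>"
    and corner: "{P * T * (1 - P) | T. True} \<subseteq> alg \<L>"
  shows "corner_algebra (alg \<L>) P"
proof
  show "(1 - P) * A * P = 0" if "A \<in> alg \<L>" for A
  proof (rule bop_eqI)
    fix x
    have "bop_apply A (bop_apply P x) \<in> range (bop_apply P)"
      using that ran by (auto simp: alg_def)
    then obtain y where "bop_apply A (bop_apply P x) = bop_apply P y" by blast
    moreover have "bop_apply P (bop_apply P y) = bop_apply P y"
      using arg_cong[OF P(2), of "\<lambda>T. bop_apply T y"] by simp
    ultimately show "bop_apply ((1 - P) * A * P) x = bop_apply 0 x" by simp
  qed
  show "\<exists>c R. c \<noteq> 0 \<and> R \<in> alg \<L> \<and> R * (1 - c *\<^sub>C A) = 1 \<and> (1 - c *\<^sub>C A) * R = 1"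
    if "A \<in> alg \<L>" for A
    using alg_resolvent[OF \<L> that] by blast
qed (use P corner one_in_alg[OF \<L>] add_in_alg[OF \<L>] mult_in_alg[OF \<L>] scale_in_alg[OF \<L>] in auto)

theorem theorem2p7:
  fixes \<L> :: "'a::complex_banach set set" and P :: "'a bop"
  assumes "subspace_lattice \<L>"
    and "P \<in> alg \<L>" and "P * P = P" and "P \<noteq> 0" and "P \<noteq> 1"
    and "range (bop_apply P) \<in> \<L>"
    and "{P * T * (1 - P) | T. True} \<subseteq> alg \<L>"
  shows "(\<forall>\<delta>\<in>linear_maps (alg \<L>). \<forall>C\<in>alg \<L>.
            jordan_derivable_at (alg \<L>) C \<delta> \<longrightarrow> derivation_on (alg \<L>) \<delta>) \<and>
         (\<forall>C\<in>alg \<L>. jordan_all_derivable_point (alg \<L>) C)"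
proof -
  interpret corner_algebra "alg \<L>" P
    by (rule corner_algebra_alg[OF assms])
  have der: "derivation_on (alg \<L>) \<delta>" if "jordan_derivable_at (alg \<L>) C \<delta>" for \<delta> C
  proof -
    interpret jordan_point "alg \<L>" P \<delta> C by unfold_locales (rule that)
    show ?thesis by (rule derivation)
  qed
  have "jordan_derivation_on (alg \<L>) \<delta>" if "derivation_on (alg \<L>) \<delta>" for \<delta>
    using that linear_maps_add[of \<delta> "alg \<L>"]
    by (simp add: derivation_on_def jordan_derivation_on_def mult add_ac)
  then show ?thesis
    using der by (auto simp: jordan_all_derivable_point_def)
qed

end
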